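(* Assume that there exists $K>0$ such that $\|f\|_{L^2}^2\le K\,\mathcal E(f,f)$ for all $f\in\mathbb D\cap L_0^2$. Let $f\in\mathbb D_0$ be such that $$\sum_{k=0}^\infty\Big(\sum_{i=k}^\infty\mathbb E[\gamma_i(f,f)]\Big)^{1/2}<+\infty.$$ Then $f$ belongs to the Gordin class $\mathcal G$.
   Context: Let $s\ge1$ and let $(\mathbf d,\varepsilon)$ be a Dirichlet form on $L^2([0,1]^s,dx)$ (with domain $\mathbf d$, $1\in\mathbf d$ and $\varepsilon(1,1)=0$) possessing a carré du champ operator $\gamma$, i.e. a symmetric bilinear $\gamma:\mathbf d\times\mathbf d\to L^1(dx)$ with $2\varepsilon(uv,u)-\varepsilon(v,u^2)=\int v\,\gamma(u,u)\,dx$ for bounded $u,v\in\mathbf d$; in particular $\varepsilon(u,u)=\frac12\int\gamma(u,u)\,dx$. Consider the product Dirichlet structure $(\Omega,\mathcal A,\mathbb P,\mathbb D,\mathcal E)=([0,1]^s,\mathcal B([0,1]^s),dx,\mathbf d,\varepsilon)^{\otimes\mathbb Z}$: $(\Omega,\mathcal A,\mathbb P)$ is the product probability space with coordinates $(X_n)_{n\in\mathbb Z}$; for a function $f$ on $\Omega$, $\gamma_i(f,f)$ denotes $\gamma$ applied to $f$ as a function of the $i$-th coordinate alone, the others being fixed; $\mathbb D$ is the set of $f\in L^2(\mathbb P)$ such that for each $i\in\mathbb Z$ the function $x_i\mapsto f$ belongs to $\mathbf d$ for almost every value of the other coordinates, and $\sum_{i\in\mathbb Z}\mathbb E[\gamma_i(f,f)]<\infty$.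 The carré du champ of the product is $\Gamma(f,f)=\sum_{i\in\mathbb Z}\gamma_i(f,f)$ and $\mathcal E(f,f)=\frac12\mathbb E[\Gamma(f,f)]$ for $f\in\mathbb D$. Let $L^2_0=\{f\in L^2(\mathbb P):\mathbb E f=0\}$, $\mathcal F_m^\infty=\sigma(X_k,\ k\ge m)$ and $\mathbb D_0=\{f\in\mathbb D:\ \mathbb E f=0,\ f\text{ is }\mathcal F_0^\infty\text{-measurable}\}$. The shift $\tau$ on $\Omega$ is defined by $X_n\circ\tau=X_{n-1}$, and $T$ on $L^1(\mathcal F_0^\infty)$ by $Tf=\mathbb E[f\mid\mathcal F_1^\infty]\circ\tau$, i.e. $Tf(x_0,x_1,\dots)=\int_{[0,1]^s}f(x,x_0,x_1,\dots)\,dx$. A function $f\in L^2(\mathcal F_0^\infty)$ belongs to the Gordin class $\mathcal G$ if $\sum_{n=0}^N T^n(f-\mathbb E f)$ remains bounded in $L^2$ as $N\to\infty$ (equivalently, converges in $L^2$). *)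

theory Defs
  imports "HOL-Probability.Probability"
begin

text \<open>
  Elements of L^2 and L^1 are represented by measurable functions; domains of forms are sets of
  functions saturated under almost everywhere equality, and forms and carre du champ operators
  respect this equality. The latter take values in L^1, so that all their identities between
  functions are almost everywhere identities.
\<close>

definition L2_space :: "'a measure \<Rightarrow> ('a \<Rightarrow> real) set" where
  "L2_space M = {f \<in> borel_measurable M. integrable M (\<lambda>x. (f x)\<^sup>2)}"

definition L2_norm :: "'a measure \<Rightarrow> ('a \<Rightarrow> real) \<Rightarrow> real" where
  "L2_norm M f = sqrt (\<integral>x. (f x)\<^sup>2 \<partial>M)"

definition ess_bounded :: "'a measure \<Rightarrow> ('a \<Rightarrow> real) \<Rightarrow> bool" where
  "ess_bounded M f \<longleftrightarrow> (\<exists>C. AE x in M. \<bar>f x\<bar> \<le> C)"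

subsection \<open>Dirichlet forms and carre du champ operators\<close>

definition dense_L2_subspace :: "'a measure \<Rightarrow> ('a \<Rightarrow> real) set \<Rightarrow> bool" where
  "dense_L2_subspace M d \<longleftrightarrow>
     d \<subseteq> L2_space M \<and>
     (\<forall>u\<in>d. \<forall>v\<in>borel_measurable M. (AE x in M. u x = v x) \<longrightarrow> v \<in> d) \<and>
     (\<lambda>_. 0) \<in> d \<and>
     (\<forall>u\<in>d. \<forall>v\<in>d. (\<lambda>x. u x + v x) \<in> d) \<and>
     (\<forall>c. \<forall>u\<in>d. (\<lambda>x. c * u x) \<in> d) \<and>
     (\<forall>f\<in>L2_space M. \<forall>e>0. \<exists>u\<in>d. L2_norm M (\<lambda>x. f x - u x) < e)"

definition nonneg_symmetric_form ::
    "'a measure \<Rightarrow> ('a \<Rightarrow> real) set \<Rightarrow> (('a \<Rightarrow> real) \<Rightarrow> ('a \<Rightarrow> real) \<Rightarrow> real) \<Rightarrow> bool" where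
  "nonneg_symmetric_form M d \<epsilon> \<longleftrightarrow>
     (\<forall>u\<in>d. \<forall>u'\<in>d. \<forall>v\<in>d. (AE x in M. u x = u' x) \<longrightarrow> \<epsilon> u v = \<epsilon> u' v) \<and>
     (\<forall>u\<in>d. \<forall>v\<in>d. \<epsilon> u v = \<epsilon> v u) \<and>
     (\<forall>u\<in>d. \<forall>v\<in>d. \<forall>w\<in>d. \<epsilon> (\<lambda>x. u x + v x) w = \<epsilon> u w + \<epsilon> v w) \<and>
     (\<forall>c. \<forall>u\<in>d. \<forall>v\<in>d. \<epsilon> (\<lambda>x. c * u x) v = c * \<epsilon> u v) \<and>
     (\<forall>u\<in>d. 0 \<le> \<epsilon> u u)"

definition form_norm ::
    "'a measure \<Rightarrow> (('a \<Rightarrow> real) \<Rightarrow> ('a \<Rightarrow> real) \<Rightarrow> real) \<Rightarrow> ('a \<Rightarrow> real) \<Rightarrow> real" where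
  "form_norm M \<epsilon> u = sqrt ((L2_norm M u)\<^sup>2 + \<epsilon> u u)"

definition closed_form ::
    "'a measure \<Rightarrow> ('a \<Rightarrow> real) set \<Rightarrow> (('a \<Rightarrow> real) \<Rightarrow> ('a \<Rightarrow> real) \<Rightarrow> real) \<Rightarrow> bool" where
  "closed_form M d \<epsilon> \<longleftrightarrow>
     (\<forall>U :: nat \<Rightarrow> 'a \<Rightarrow> real.
        (\<forall>n. U n \<in> d) \<longrightarrow>
        (\<forall>e>0. \<exists>N. \<forall>m\<ge>N. \<forall>n\<ge>N. form_norm M \<epsilon> (\<lambda>x. U m x - U n x) < e) \<longrightarrow>
        (\<exists>u\<in>d. (\<lambda>n. form_norm M \<epsilon> (\<lambda>x. U n x - u x)) \<longlonglongrightarrow> 0))"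

definition unit_contraction_operates ::
    "('a \<Rightarrow> real) set \<Rightarrow> (('a \<Rightarrow> real) \<Rightarrow> ('a \<Rightarrow> real) \<Rightarrow> real) \<Rightarrow> bool" where
  "unit_contraction_operates d \<epsilon> \<longleftrightarrow>
     (\<forall>u\<in>d. (\<lambda>x. min (max (u x) 0) 1) \<in> d \<and>
        \<epsilon> (\<lambda>x. min (max (u x) 0) 1) (\<lambda>x. min (max (u x) 0) 1) \<le> \<epsilon> u u)"

definition dirichlet_form ::
    "'a measure \<Rightarrow> ('a \<Rightarrow> real) set \<Rightarrow> (('a \<Rightarrow> real) \<Rightarrow> ('a \<Rightarrow> real) \<Rightarrow> real) \<Rightarrow> bool" where
  "dirichlet_form M d \<epsilon> \<longleftrightarrow>
     dense_L2_subspace M d \<and> nonneg_symmetric_form M d \<epsilon> \<and> closed_form M d \<epsilon> \<and>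
     unit_contraction_operates d \<epsilon>"

text \<open>
  The characterising identity only concerns bounded functions (which form an algebra contained in
  the domain). The energy formula for all functions in the domain is what the identity gives for
  \<open>v = 1\<close>, extended from bounded functions by continuity.
\<close>

definition carre_du_champ ::
    "'a measure \<Rightarrow> ('a \<Rightarrow> real) set \<Rightarrow> (('a \<Rightarrow> real) \<Rightarrow> ('a \<Rightarrow> real) \<Rightarrow> real) \<Rightarrow>
     (('a \<Rightarrow> real) \<Rightarrow> ('a \<Rightarrow> real) \<Rightarrow> 'a \<Rightarrow> real) \<Rightarrow> bool" where
  "carre_du_champ M d \<epsilon> \<gamma> \<longleftrightarrow>
     (\<forall>u\<in>d. \<forall>v\<in>d. integrable M (\<gamma> u v)) \<and>
     (\<forall>u\<in>d. \<forall>u'\<in>d. \<forall>v\<in>d. (AE x in M. u x = u' x) \<longrightarrow> (AE x in M. \<gamma> u v x = \<gamma> u' v x)) \<and>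
     (\<forall>u\<in>d. \<forall>v\<in>d. AE x in M. \<gamma> u v x = \<gamma> v u x) \<and>
     (\<forall>u\<in>d. \<forall>v\<in>d. \<forall>w\<in>d. AE x in M. \<gamma> (\<lambda>x. u x + v x) w x = \<gamma> u w x + \<gamma> v w x) \<and>
     (\<forall>c. \<forall>u\<in>d. \<forall>v\<in>d. AE x in M. \<gamma> (\<lambda>x. c * u x) v x = c * \<gamma> u v x) \<and>
     (\<forall>u\<in>d. \<forall>v\<in>d. ess_bounded M u \<longrightarrow> ess_bounded M v \<longrightarrow>
        2 * \<epsilon> (\<lambda>x. u x * v x) u - \<epsilon> v (\<lambda>x. (u x)\<^sup>2) = (\<integral>x. v x * \<gamma> u u x \<partial>M)) \<and>
     (\<forall>u\<in>d. \<epsilon> u u = (\<integral>x. \<gamma> u u x \<partial>M) / 2)"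

subsection \<open>The product structure\<close>

definition cube_measure :: "(real ^ 's) measure" where
  "cube_measure = restrict_space lborel {x. \<forall>j. 0 \<le> x $ j \<and> x $ j \<le> 1}"

definition product_measure :: "(int \<Rightarrow> real ^ 's) measure" where
  "product_measure = PiM UNIV (\<lambda>_. cube_measure)"

definition coord_section :: "((int \<Rightarrow> 'b) \<Rightarrow> real) \<Rightarrow> int \<Rightarrow> (int \<Rightarrow> 'b) \<Rightarrow> 'b \<Rightarrow> real" where
  "coord_section f i \<omega> = (\<lambda>x. f (fun_upd \<omega> i x))"

definition coord_gamma ::
    "(('b \<Rightarrow> real) \<Rightarrow> ('b \<Rightarrow> real) \<Rightarrow> 'b \<Rightarrow> real) \<Rightarrow> int \<Rightarrow> ((int \<Rightarrow> 'b) \<Rightarrow> real) \<Rightarrow>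
     (int \<Rightarrow> 'b) \<Rightarrow> real" where
  "coord_gamma \<gamma> i f \<omega> = \<gamma> (coord_section f i \<omega>) (coord_section f i \<omega>) (\<omega> i)"

text \<open>
  The expectation of \<open>\<gamma>\<^sub>i(f,f)\<close>. For fixed other coordinates, \<open>\<gamma>\<^sub>i(f,f)\<close> is an element of L^1 in the
  \<open>i\<close>-th coordinate, and the representatives chosen for different values of the other coordinates
  need not fit together to a jointly measurable function. The expectation of a jointly measurable
  version is therefore written as an iterated integral, first over the \<open>i\<close>-th coordinate and then
  over the remaining ones (the inner integral does not depend on \<open>\<omega> i\<close>). The inner integral is
  nonnegative, being twice the energy of the section.
\<close>

definition mean_coord_gamma ::
    "((real ^ 's \<Rightarrow> real) \<Rightarrow> (real ^ 's \<Rightarrow> real) \<Rightarrow> real ^ 's \<Rightarrow> real) \<Rightarrow> int \<Rightarrow>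
     ((int \<Rightarrow> real ^ 's) \<Rightarrow> real) \<Rightarrow> ennreal" where
  "mean_coord_gamma \<gamma> i f =
     (\<integral>\<^sup>+\<omega>. ennreal (\<integral>x. coord_gamma \<gamma> i f (fun_upd \<omega> i x) \<partial>cube_measure) \<partial>product_measure)"

text \<open>The expectation of \<open>\<Gamma>(f,f)\<close>, with sum and expectation interchanged by monotone convergence.\<close>

definition mean_Gamma ::
    "((real ^ 's \<Rightarrow> real) \<Rightarrow> (real ^ 's \<Rightarrow> real) \<Rightarrow> real ^ 's \<Rightarrow> real) \<Rightarrow>
     ((int \<Rightarrow> real ^ 's) \<Rightarrow> real) \<Rightarrow> ennreal" where
  "mean_Gamma \<gamma> f = (\<Sum>\<^sub>\<infinity>i\<in>UNIV. mean_coord_gamma \<gamma> i f)"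

definition product_domain ::
    "(real ^ 's \<Rightarrow> real) set \<Rightarrow>
     ((real ^ 's \<Rightarrow> real) \<Rightarrow> (real ^ 's \<Rightarrow> real) \<Rightarrow> real ^ 's \<Rightarrow> real) \<Rightarrow>
     ((int \<Rightarrow> real ^ 's) \<Rightarrow> real) set" where
  "product_domain d \<gamma> =
     {f \<in> L2_space product_measure.
        (\<forall>i. AE \<omega> in product_measure. coord_section f i \<omega> \<in> d) \<and> mean_Gamma \<gamma> f < \<infinity>}"

text \<open>Only meaningful on \<open>product_domain d \<gamma>\<close>, where \<open>mean_Gamma \<gamma> f\<close> is finite.\<close>

definition product_energy ::
    "((real ^ 's \<Rightarrow> real) \<Rightarrow> (real ^ 's \<Rightarrow> real) \<Rightarrow> real ^ 's \<Rightarrow> real) \<Rightarrow>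
     ((int \<Rightarrow> real ^ 's) \<Rightarrow> real) \<Rightarrow> real" where
  "product_energy \<gamma> f = enn2real (mean_Gamma \<gamma> f) / 2"

definition L2_centered :: "((int \<Rightarrow> real ^ 's) \<Rightarrow> real) set" where
  "L2_centered = {f \<in> L2_space product_measure. (\<integral>\<omega>. f \<omega> \<partial>product_measure) = 0}"

definition future_algebra :: "int \<Rightarrow> (int \<Rightarrow> real ^ 's) measure" where
  "future_algebra m =
     sigma (space product_measure)
       (\<Union>k\<in>{m..}. {(\<lambda>\<omega>. \<omega> k) -` A \<inter> space product_measure | A. A \<in> sets cube_measure})"

definition product_domain0 ::
    "(real ^ 's \<Rightarrow> real) set \<Rightarrow>
     ((real ^ 's \<Rightarrow> real) \<Rightarrow> (real ^ 's \<Rightarrow> real) \<Rightarrow> real ^ 's \<Rightarrow> real) \<Rightarrow>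
     ((int \<Rightarrow> real ^ 's) \<Rightarrow> real) set" where
  "product_domain0 d \<gamma> =
     {f \<in> product_domain d \<gamma>.
        (\<integral>\<omega>. f \<omega> \<partial>product_measure) = 0 \<and> f \<in> borel_measurable (future_algebra 0)}"

subsection \<open>The Gordin class\<close>

definition shift :: "(int \<Rightarrow> 'b) \<Rightarrow> int \<Rightarrow> 'b" where
  "shift \<omega> = (\<lambda>n. \<omega> (n - 1))"

definition transfer_op :: "((int \<Rightarrow> real ^ 's) \<Rightarrow> real) \<Rightarrow> (int \<Rightarrow> real ^ 's) \<Rightarrow> real" where
  "transfer_op f = real_cond_exp product_measure (future_algebra 1) f \<circ> shift"

definition gordin_sum ::
    "nat \<Rightarrow> ((int \<Rightarrow> real ^ 's) \<Rightarrow> real) \<Rightarrow> (int \<Rightarrow> real ^ 's) \<Rightarrow> real" where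
  "gordin_sum N f =
     (\<lambda>\<omega>. \<Sum>n\<le>N. (transfer_op ^^ n) (\<lambda>\<eta>. f \<eta> - (\<integral>\<xi>. f \<xi> \<partial>product_measure)) \<omega>)"

text \<open>Membership of the sums in L^2 is required explicitly since \<open>L2_norm\<close> is 0 outside L^2.\<close>

definition gordin_class :: "((int \<Rightarrow> real ^ 's) \<Rightarrow> real) set" where
  "gordin_class =
     {f \<in> L2_space product_measure. f \<in> borel_measurable (future_algebra 0) \<and>
        (\<exists>C. \<forall>N. gordin_sum N f \<in> L2_space product_measure \<and>
                 L2_norm product_measure (gordin_sum N f) \<le> C)}"

end

theory Submission
  imports Defs
begin

text \<open>
  Iterating the transfer operator amounts to conditioning on a more and more distant future:
  \<open>T\<^sup>n f\<close> is the conditional expectation of \<open>f\<close> given the coordinates from \<open>n\<close> on, composed with the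
  \<open>n\<close>-th power of the shift (\<open>transfer_op_pow\<close>). The shift preserves the measure, so by the triangle
  inequality it is enough to bound the \<open>L\<^sup>2\<close> norm of this conditional expectation by the square root
  of \<open>K/2\<close> times the energy tail \<open>\<Sum>i\<ge>n. E \<gamma>\<^sub>i(f,f)\<close>; these bounds are summable by hypothesis.

  One could apply the Poincare inequality to the conditional expectation itself, but this requires to
  show that it lies in the domain of the product form, with control on its energy. Instead the
  inequality is only used for functions of a single coordinate, where it says that the variance of
  \<open>u\<close> is at most \<open>K \<epsilon>(u,u)\<close> (\<open>variance_le_energy\<close>), and it is transported to the product by an
  Efron-Stein argument that does not involve the form. Conditional expectations given the coordinates
  outside a set \<open>J\<close> are averages over an independent copy of the coordinates in \<open>J\<close>. These averaging
  operators are commuting orthogonal projections. Therefore averaging over one more coordinate \<open>i\<close>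
  lowers the squared norm by at most the mean variance of \<open>f\<close> in its \<open>i\<close>-th coordinate
  (\<open>nsq_avg_increment\<close>), whatever was averaged before. For centered \<open>f\<close> the squared norm decreases to
  \<open>0\<close> as more and more coordinates are averaged, by the zero-one law (\<open>tail_trivial_L2\<close>), so it is
  bounded by the sum of the variances of the coordinates not yet averaged (\<open>nsq_avg_past_le\<close>), hence
  by the energy tail.
\<close>

section \<open>Resampling coordinates of an independent family\<close>

text \<open>
  Averaging over the coordinates in \<open>J\<close> means replacing them by an independent copy \<open>\<eta>\<close>. Writing
  this replacement as a map of the whole pair \<open>(\<omega>, \<eta>)\<close> makes every statement on conditional
  expectations given the remaining coordinates an instance of Fubini's theorem.
\<close>

definition mix :: "'i set \<Rightarrow> ('i \<Rightarrow> 'b) \<Rightarrow> ('i \<Rightarrow> 'b) \<Rightarrow> 'i \<Rightarrow> 'b" where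
  "mix J \<eta> \<omega> = (\<lambda>k. if k \<in> J then \<eta> k else \<omega> k)"

lemma mix_mix: "mix K \<eta>' (mix J \<eta> \<omega>) = mix (J \<union> K) (mix K \<eta>' \<eta>) \<omega>"
  by (auto simp: mix_def)

lemma mix_mix_same: "mix J \<eta>' (mix J \<eta> \<omega>) = mix J \<eta>' \<omega>"
  by (auto simp: mix_def)

locale iid_product = N: prob_space N for N :: "'b measure" +
  fixes P :: "('i \<Rightarrow> 'b) measure"
  assumes P_eq: "P = PiM UNIV (\<lambda>_. N)"
begin

sublocale P: prob_space P
  unfolding P_eq by (rule prob_space_PiM) (rule N.prob_space_axioms)

sublocale PP: pair_prob_space P P ..

lemma space_P: "space P = {\<omega>. \<forall>i. \<omega> i \<in> space N}"
  by (auto simp: P_eq space_PiM)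

lemma measurable_coord [measurable]: "(\<lambda>\<omega>. \<omega> i) \<in> measurable P N"
  unfolding P_eq by measurable

lemma measurable_into_P:
  assumes "\<And>i. (\<lambda>x. g x i) \<in> measurable M N"
  shows "g \<in> measurable M P"
  unfolding P_eq using assms
  by (intro measurable_PiM_single') (auto dest: measurable_space simp: Pi_iff)

lemma measurable_mix [measurable]: "(\<lambda>(\<omega>, \<eta>). mix J \<eta> \<omega>) \<in> measurable (P \<Otimes>\<^sub>M P) P"
proof (rule measurable_into_P)
  fix i show "(\<lambda>x. (case x of (\<omega>, \<eta>) \<Rightarrow> mix J \<eta> \<omega>) i) \<in> measurable (P \<Otimes>\<^sub>M P) N"
    by (cases "i \<in> J") (simp_all add: mix_def case_prod_beta)
qed

lemma measurable_mix_right [measurable]: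
  assumes "\<omega> \<in> space P" shows "(\<lambda>\<eta>. mix J \<eta> \<omega>) \<in> measurable P P"
  using measurable_compose[OF measurable_Pair1'[OF assms, of P] measurable_mix, of J] by simp

lemma mix_in_space: "\<omega> \<in> space P \<Longrightarrow> \<eta> \<in> space P \<Longrightarrow> mix J \<eta> \<omega> \<in> space P"
  by (auto simp: space_P mix_def)

lemma emeasure_box:
  assumes "finite J" "\<And>j. j \<in> J \<Longrightarrow> X j \<in> sets N"
  shows "emeasure P {\<omega>\<in>space P. \<forall>j\<in>J. \<omega> j \<in> X j} = (\<Prod>j\<in>J. emeasure N (X j))"
proof -
  interpret I: product_prob_space "\<lambda>_::'i. N" UNIV ..
  show ?thesis using assms unfolding P_eq by (intro I.emeasure_PiM_Collect) auto
qed

lemma box_eq: "prod_emb UNIV (\<lambda>_. N) J (Pi\<^sub>E J X) = {\<omega>\<in>space P. \<forall>j\<in>J. \<omega> j \<in> X j}"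
  by (auto simp: prod_emb_def P_eq space_PiM PiE_iff Pi_iff extensional_def)

lemma sets_box:
  assumes "finite J" "\<And>j. j \<in> J \<Longrightarrow> X j \<in> sets N"
  shows "{\<omega>\<in>space P. \<forall>j\<in>J. \<omega> j \<in> X j} \<in> sets P"
  using assms by measurable

text \<open>
  Both arguments have independent coordinates with law \<open>N\<close>, so a family that takes each coordinate
  from one of them has this property too. On boxes the two measures agree because the constraints
  split into those on \<open>\<eta>\<close> (indices in \<open>J\<close>) and those on \<open>\<omega>\<close> (all others).
\<close>

lemma distr_mix: "distr (P \<Otimes>\<^sub>M P) P (\<lambda>(\<omega>, \<eta>). mix J \<eta> \<omega>) = P"
proof -
  interpret I: product_prob_space "\<lambda>_::'i. N" UNIV ..
  have "PiM UNIV (\<lambda>_. N) = distr (P \<Otimes>\<^sub>M P) P (\<lambda>(\<omega>, \<eta>). mix J \<eta> \<omega>)"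
  proof (rule I.PiM_eq[symmetric])
    fix K and X :: "'i \<Rightarrow> 'b set"
    assume K: "finite K" "K \<subseteq> UNIV" and X: "\<And>j. j \<in> K \<Longrightarrow> X j \<in> sets N"
    let ?B = "\<lambda>L. {\<omega>\<in>space P. \<forall>j\<in>L. \<omega> j \<in> X j}"
    have [measurable]: "?B L \<in> sets P" if "L \<subseteq> K" for L
      using that X K by (intro sets_box) (auto intro: finite_subset)
    have "emeasure (distr (P \<Otimes>\<^sub>M P) P (\<lambda>(\<omega>, \<eta>). mix J \<eta> \<omega>)) (?B K) =
      emeasure (P \<Otimes>\<^sub>M P) (?B (K - J) \<times> ?B (K \<inter> J))"
      by (subst emeasure_distr)
        (auto intro!: arg_cong[of _ _ "emeasure (P \<Otimes>\<^sub>M P)"] simp: space_pair_measure mix_in_space,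
         auto simp: mix_def split: if_splits)
    also have "\<dots> = emeasure P (?B (K - J)) * emeasure P (?B (K \<inter> J))"
      by (rule P.emeasure_pair_measure_Times) auto
    also have "\<dots> = (\<Prod>j\<in>K. emeasure N (X j))"
      using K(1) X by (subst (1 2) emeasure_box) (auto simp: prod.Int_Diff[of K _ J] mult.commute)
    finally show "emeasure (distr (P \<Otimes>\<^sub>M P) P (\<lambda>(\<omega>, \<eta>). mix J \<eta> \<omega>))
        (prod_emb UNIV (\<lambda>_. N) K (Pi\<^sub>E K X)) = (\<Prod>j\<in>K. emeasure N (X j))"
      by (simp add: box_eq)
  qed (simp add: P_eq)
  then show ?thesis by (simp add: P_eq)
qed

subsection \<open>Averaging operators\<close>

text \<open>
  A pointwise defined version of the conditional expectation of \<open>f\<close> given the coordinates outside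
  \<open>J\<close>; see \<open>real_cond_exp_eq_avg\<close>.
\<close>

definition avg :: "'i set \<Rightarrow> (('i \<Rightarrow> 'b) \<Rightarrow> real) \<Rightarrow> ('i \<Rightarrow> 'b) \<Rightarrow> real" where
  "avg J f \<omega> = (\<integral>\<eta>. f (mix J \<eta> \<omega>) \<partial>P)"

lemma avg_measurable [measurable]:
  assumes [measurable]: "f \<in> borel_measurable P" shows "avg J f \<in> borel_measurable P"
  unfolding avg_def
  using measurable_compose[OF measurable_mix assms, of J]
  by (intro P.borel_measurable_lebesgue_integral) (simp add: case_prod_beta')

lemma avg_mix: "avg J f (mix J \<eta> \<omega>) = avg J f \<omega>"
  by (simp add: avg_def mix_mix_same)

context
  fixes f :: "('i \<Rightarrow> 'b) \<Rightarrow> real" and J :: "'i set"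
  assumes f: "integrable P f"
begin

lemma integrable_pair_mix: "integrable (P \<Otimes>\<^sub>M P) (\<lambda>(\<omega>, \<eta>). f (mix J \<eta> \<omega>))"
  using f integrable_distr[OF measurable_mix[of J], of f] unfolding distr_mix
  by (simp add: case_prod_beta')

lemma AE_integrable_mix: "AE \<omega> in P. integrable P (\<lambda>\<eta>. f (mix J \<eta> \<omega>))"
  using PP.AE_integrable_fst'[OF integrable_pair_mix] by simp

lemma avg_integrable: "integrable P (avg J f)"
  using PP.integrable_fst'[OF integrable_pair_mix] by (simp add: avg_def[abs_def])

lemma integral_avg: "(\<integral>\<omega>. avg J f \<omega> \<partial>P) = (\<integral>\<omega>. f \<omega> \<partial>P)"
proof -
  have "(\<integral>\<omega>. avg J f \<omega> \<partial>P) = (\<integral>x. (case x of (\<omega>, \<eta>) \<Rightarrow> f (mix J \<eta> \<omega>)) \<partial>(P \<Otimes>\<^sub>M P))"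
    using PP.integral_fst'[OF integrable_pair_mix] by (simp add: avg_def[abs_def])
  also have "\<dots> = (\<integral>\<omega>. f \<omega> \<partial>distr (P \<Otimes>\<^sub>M P) P (\<lambda>(\<omega>, \<eta>). mix J \<eta> \<omega>))"
    using f by (subst integral_distr) (auto simp: case_prod_beta')
  finally show ?thesis by (simp add: distr_mix)
qed

end

lemma avg_diff:
  assumes "integrable P f" "integrable P g"
  shows "AE \<omega> in P. avg J (\<lambda>x. f x - g x) \<omega> = avg J f \<omega> - avg J g \<omega>"
  using AE_integrable_mix[OF assms(1), of J] AE_integrable_mix[OF assms(2), of J]
  by eventually_elim (simp add: avg_def)

text \<open>
  The tower property; as the right hand side is symmetric in \<open>J\<close> and \<open>K\<close>, it also says that the
  averaging operators commute, which rests on the independence of the coordinates. For fixed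
  \<open>\<omega>\<close> the inner average ranges over \<open>\<eta>\<close> with its coordinates in \<open>K\<close> resampled, which does not
  change the integral.
\<close>

lemma avg_avg:
  assumes f: "integrable P f"
  shows "AE \<omega> in P. avg J (avg K f) \<omega> = avg (J \<union> K) f \<omega>"
  using AE_integrable_mix[OF f, of "J \<union> K"]
proof eventually_elim
  case (elim \<omega>)
  show ?case using integral_avg[OF elim, of K] by (simp add: avg_def mix_mix)
qed

abbreviation nsq :: "(('i \<Rightarrow> 'b) \<Rightarrow> real) \<Rightarrow> real" where
  "nsq f \<equiv> \<integral>\<omega>. (f \<omega>)\<^sup>2 \<partial>P"

lemma L2_measurable [measurable_dest]: "f \<in> L2_space P \<Longrightarrow> f \<in> borel_measurable P"
  and L2_integrable_sq: "f \<in> L2_space P \<Longrightarrow> integrable P (\<lambda>x. (f x)\<^sup>2)"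
  by (auto simp: L2_space_def)

lemma L2_integrable: "f \<in> L2_space P \<Longrightarrow> integrable P f"
  by (rule P.square_integrable_imp_integrable) (auto simp: L2_space_def)

lemma L2_integrable_mult:
  assumes "f \<in> L2_space P" "g \<in> L2_space P" shows "integrable P (\<lambda>x. f x * g x)"
proof (rule Bochner_Integration.integrable_bound[of _ "\<lambda>x. (f x)\<^sup>2 + (g x)\<^sup>2"])
  show "AE x in P. norm (f x * g x) \<le> norm ((f x)\<^sup>2 + (g x)\<^sup>2)"
  proof (rule AE_I2)
    fix x
    have "2 * (\<bar>f x\<bar> * \<bar>g x\<bar>) \<le> (f x)\<^sup>2 + (g x)\<^sup>2"
      using sum_squares_bound[of "\<bar>f x\<bar>" "\<bar>g x\<bar>"] by simp
    moreover have "0 \<le> \<bar>f x\<bar> * \<bar>g x\<bar>" by simp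
    ultimately have "\<bar>f x\<bar> * \<bar>g x\<bar> \<le> (f x)\<^sup>2 + (g x)\<^sup>2" by linarith
    then show "norm (f x * g x) \<le> norm ((f x)\<^sup>2 + (g x)\<^sup>2)" by (simp add: abs_mult)
  qed
qed (use assms in \<open>auto simp: L2_space_def\<close>)

lemma L2_add: "f \<in> L2_space P \<Longrightarrow> g \<in> L2_space P \<Longrightarrow> (\<lambda>x. f x + g x) \<in> L2_space P"
  using L2_integrable_mult[of f g]
  by (auto simp: L2_space_def power2_sum mult.assoc)

lemma L2_diff: "f \<in> L2_space P \<Longrightarrow> g \<in> L2_space P \<Longrightarrow> (\<lambda>x. f x - g x) \<in> L2_space P"
  using L2_integrable_mult[of f g]
  by (auto simp: L2_space_def power2_diff mult.assoc)

lemma L2_cmult: "f \<in> L2_space P \<Longrightarrow> (\<lambda>x. c * f x) \<in> L2_space P"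
  by (auto simp: L2_space_def power_mult_distrib)

lemma L2_const: "(\<lambda>x. c) \<in> L2_space P"
  by (auto simp: L2_space_def)

text \<open>
  The difference of the two sides is a variance over the resampled coordinates.
\<close>

lemma avg_sq_le:
  assumes f: "f \<in> L2_space P"
  shows "AE \<omega> in P. (avg J f \<omega>)\<^sup>2 \<le> avg J (\<lambda>x. (f x)\<^sup>2) \<omega>"
  using AE_integrable_mix[OF L2_integrable[OF f], of J] AE_integrable_mix[OF L2_integrable_sq[OF f], of J]
proof eventually_elim
  case (elim \<omega>)
  then show ?case
    using P.variance_eq[of "\<lambda>\<eta>. f (mix J \<eta> \<omega>)"] P.variance_positive[of "\<lambda>\<eta>. f (mix J \<eta> \<omega>)"]
    by (simp add: avg_def)
qed

lemma avg_L2: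
  assumes f: "f \<in> L2_space P" shows "avg J f \<in> L2_space P"
  unfolding L2_space_def
proof (safe)
  show [measurable]: "avg J f \<in> borel_measurable P" using f by measurable
  show "integrable P (\<lambda>x. (avg J f x)\<^sup>2)"
    by (rule Bochner_Integration.integrable_bound[OF avg_integrable[OF L2_integrable_sq[OF f], of J]])
      (use avg_sq_le[OF f, of J] in auto)
qed

lemma nsq_avg_le:
  assumes f: "f \<in> L2_space P" shows "nsq (avg J f) \<le> nsq f"
  using integral_mono_AE[OF L2_integrable_sq[OF avg_L2[OF f]] avg_integrable[OF L2_integrable_sq[OF f]] avg_sq_le[OF f]]
  by (simp add: integral_avg[OF L2_integrable_sq[OF f]])

text \<open>
  Pythagoras: averaging is an orthogonal projection in \<open>L\<^sup>2\<close>. It is obtained by integrating the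
  conditional variance, since \<open>avg J f\<close> does not see the resampled coordinates.
\<close>

lemma nsq_eq_avg_plus_diff:
  assumes f: "f \<in> L2_space P"
  shows "nsq f = nsq (avg J f) + nsq (\<lambda>x. f x - avg J f x)"
proof -
  note 1 = L2_integrable[OF f] and 2 = L2_integrable_sq[OF f]
  note 3 = L2_diff[OF f avg_L2[OF f, of J]]
  have [measurable]: "f \<in> borel_measurable P" using f by (rule L2_measurable)
  have "AE \<omega> in P. avg J (\<lambda>x. (f x - avg J f x)\<^sup>2) \<omega> = avg J (\<lambda>x. (f x)\<^sup>2) \<omega> - (avg J f \<omega>)\<^sup>2"
    using AE_integrable_mix[OF 1, of J] AE_integrable_mix[OF 2, of J]
  proof eventually_elim
    case (elim \<omega>)
    then show ?case
      using P.variance_eq[of "\<lambda>\<eta>. f (mix J \<eta> \<omega>)"] 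
      by (simp add: avg_def[of J "\<lambda>x. (f x - avg J f x)\<^sup>2"] avg_mix) (simp add: avg_def)
  qed
  then have "(\<integral>\<omega>. avg J (\<lambda>x. (f x - avg J f x)\<^sup>2) \<omega> \<partial>P) =
      (\<integral>\<omega>. avg J (\<lambda>x. (f x)\<^sup>2) \<omega> - (avg J f \<omega>)\<^sup>2 \<partial>P)"
    by (intro integral_cong_AE) measurable
  also have "\<dots> = nsq f - nsq (avg J f)"
    using avg_integrable[OF 2] L2_integrable_sq[OF avg_L2[OF f]]
    by (simp add: integral_avg[OF 2])
  finally show ?thesis by (simp add: integral_avg[OF L2_integrable_sq[OF 3]])
qed

text \<open>
  The loss of norm caused by averaging over \<open>K\<close> is largest when nothing was averaged before. Indeed
  the left hand side is the squared norm of \<open>avg J f - avg (J \<union> K) f\<close>, and as the operators commute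
  this function is the contraction \<open>avg J\<close> applied to \<open>f - avg K f\<close>. With \<open>K\<close> a single coordinate this
  is the step that bounds a variance by a sum of one-coordinate variances.
\<close>

lemma nsq_avg_increment:
  assumes f: "f \<in> L2_space P"
  shows "nsq (avg J f) - nsq (avg (J \<union> K) f) \<le> nsq f - nsq (avg K f)"
proof -
  let ?g = "\<lambda>x. f x - avg K f x"
  have g: "?g \<in> L2_space P" by (intro L2_diff avg_L2 f)
  note 1 = avg_avg[OF L2_integrable[OF f], of K J] avg_avg[OF L2_integrable[OF f], of J K]
  have [measurable]: "f \<in> borel_measurable P" using f by measurable
  have "nsq (avg K (avg J f)) = nsq (avg (J \<union> K) f)"
    by (rule integral_cong_AE) (use 1(1) in \<open>auto simp: Un_commute\<close>)
  moreover have "nsq (\<lambda>x. avg J f x - avg K (avg J f) x) = nsq (avg J ?g)"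
  proof (rule integral_cong_AE)
    have "AE \<omega> in P. avg J ?g \<omega> = avg J f \<omega> - avg J (avg K f) \<omega>"
      by (intro avg_diff L2_integrable avg_L2 f)
    with 1 show "AE x in P. (avg J f x - avg K (avg J f) x)\<^sup>2 = (avg J ?g x)\<^sup>2"
      by eventually_elim (simp add: Un_commute)
  qed measurable
  moreover have "nsq (avg J ?g) \<le> nsq ?g" by (rule nsq_avg_le[OF g])
  ultimately show ?thesis
    using nsq_eq_avg_plus_diff[OF avg_L2[OF f, of J], of K] nsq_eq_avg_plus_diff[OF f, of K]
    by simp
qed


text \<open>
  The events of \<open>F\<close> are unaffected by resampling the coordinates in \<open>J\<close>, so their indicators can be
  pulled out of the average.
\<close>

lemma real_cond_exp_eq_avg:
  assumes F: "subalgebra P F"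
    and coord: "\<And>i. i \<notin> J \<Longrightarrow> (\<lambda>\<omega>. \<omega> i) \<in> measurable F N"
    and inv: "\<And>A \<omega> \<eta>. A \<in> sets F \<Longrightarrow> \<omega> \<in> space P \<Longrightarrow> \<eta> \<in> space P \<Longrightarrow> mix J \<eta> \<omega> \<in> A \<longleftrightarrow> \<omega> \<in> A"
    and f: "integrable P f"
  shows "AE \<omega> in P. real_cond_exp P F f \<omega> = avg J f \<omega>"
proof -
  interpret finite_measure_subalgebra P F by unfold_locales (rule F)
  have space_F: "space F = space P" using F by (simp add: subalgebra_def)
  have mix_F: "(\<lambda>(\<omega>, \<eta>). mix J \<eta> \<omega>) \<in> measurable (F \<Otimes>\<^sub>M P) P"
  proof (rule measurable_into_P)
    fix i
    have [measurable]: "i \<notin> J \<Longrightarrow> (\<lambda>\<omega>. \<omega> i) \<in> measurable F N" by (rule coord)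
    show "(\<lambda>x. (case x of (\<omega>, \<eta>) \<Rightarrow> mix J \<eta> \<omega>) i) \<in> measurable (F \<Otimes>\<^sub>M P) N"
      by (cases "i \<in> J") (simp_all add: mix_def case_prod_beta)
  qed
  show ?thesis
  proof (rule real_cond_exp_charact)
    show "avg J f \<in> borel_measurable F"
      unfolding avg_def
      using measurable_compose[OF mix_F borel_measurable_integrable[OF f]]
      by (intro P.borel_measurable_lebesgue_integral) (simp add: case_prod_beta')
  next
    fix A assume A: "A \<in> sets F"
    then have AP: "A \<in> sets P" using F by (auto simp: subalgebra_def)
    have "(\<integral>x\<in>A. f x \<partial>P) = (\<integral>\<omega>. avg J (\<lambda>x. indicator A x * f x) \<omega> \<partial>P)"
      using integral_avg[OF integrable_mult_indicator[OF AP f], of J]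
      by (simp add: set_lebesgue_integral_def)
    also have "\<dots> = (\<integral>\<omega>. indicator A \<omega> * avg J f \<omega> \<partial>P)"
    proof (rule Bochner_Integration.integral_cong[OF refl])
      fix \<omega> assume \<omega>: "\<omega> \<in> space P"
      have "avg J (\<lambda>x. indicator A x * f x) \<omega> = (\<integral>\<eta>. indicator A \<omega> * f (mix J \<eta> \<omega>) \<partial>P)"
        unfolding avg_def
        by (rule Bochner_Integration.integral_cong[OF refl])
          (simp add: indicator_def inv[OF A \<omega>])
      then show "avg J (\<lambda>x. indicator A x * f x) \<omega> = indicator A \<omega> * avg J f \<omega>"
        by (simp add: avg_def)
    qed
    finally show "(\<integral>x\<in>A. f x \<partial>P) = (\<integral>x\<in>A. avg J f x \<partial>P)"
      by (simp add: set_lebesgue_integral_def)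
  qed (use f avg_integrable[OF f] in auto)
qed

lemma avg_UNIV: "avg UNIV f \<omega> = (\<integral>\<eta>. f \<eta> \<partial>P)"
  by (simp add: avg_def mix_def)

lemma avg_cmult: "avg J (\<lambda>x. c * f x) \<omega> = c * avg J f \<omega>"
  by (simp add: avg_def)

lemma avg_const: "avg J (\<lambda>x. c) \<omega> = c"
  by (simp add: avg_def P.prob_space)

text \<open>
  The mean is the average over all coordinates, so this is the contraction property followed by
  Pythagoras for \<open>J = UNIV\<close>.
\<close>

lemma nsq_avg_centered_le:
  assumes f: "f \<in> L2_space P"
  shows "nsq (\<lambda>\<omega>. avg J f \<omega> - (\<integral>\<eta>. f \<eta> \<partial>P)) \<le> nsq f"
proof -
  have "nsq (avg J f) = (\<integral>\<eta>. f \<eta> \<partial>P)\<^sup>2 + nsq (\<lambda>\<omega>. avg J f \<omega> - (\<integral>\<eta>. f \<eta> \<partial>P))"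
    using nsq_eq_avg_plus_diff[OF avg_L2[OF f, of J], of UNIV]
    by (simp add: avg_UNIV integral_avg[OF L2_integrable[OF f]] P.prob_space)
  then show ?thesis
    using nsq_avg_le[OF f, of J] zero_le_power2[of "\<integral>\<eta>. f \<eta> \<partial>P"] by linarith
qed

lemma nsq_add_le:
  assumes f: "f \<in> L2_space P" and g: "g \<in> L2_space P" and t: "0 < t"
  shows "nsq (\<lambda>x. f x + g x) \<le> (1 + t) * nsq f + (1 + 1 / t) * nsq g"
proof -
  have "nsq (\<lambda>x. f x + g x) \<le> (\<integral>x. (1 + t) * (f x)\<^sup>2 + (1 + 1 / t) * (g x)\<^sup>2 \<partial>P)"
  proof (rule integral_mono)
    fix x
    have "(1 + t) * (f x)\<^sup>2 + (1 + 1 / t) * (g x)\<^sup>2 - (f x + g x)\<^sup>2 = (t * f x - g x)\<^sup>2 / t"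
      using t by (simp add: power2_eq_square field_simps)
    moreover have "0 \<le> (t * f x - g x)\<^sup>2 / t" using t by simp
    ultimately show "(f x + g x)\<^sup>2 \<le> (1 + t) * (f x)\<^sup>2 + (1 + 1 / t) * (g x)\<^sup>2" by linarith
  qed (use L2_integrable_sq[OF L2_add[OF f g]] L2_integrable_sq[OF f] L2_integrable_sq[OF g] in auto)
  also have "\<dots> = (1 + t) * nsq f + (1 + 1 / t) * nsq g"
    using L2_integrable_sq[OF f] L2_integrable_sq[OF g] by simp
  finally show ?thesis .
qed

lemma L2_sum:
  "finite I \<Longrightarrow> (\<And>i. i \<in> I \<Longrightarrow> f i \<in> L2_space P) \<Longrightarrow> (\<lambda>x. \<Sum>i\<in>I. f i x) \<in> L2_space P"
  by (induction I rule: finite_induct) (auto intro: L2_const L2_add)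

text \<open>
  The triangle inequality in \<open>L\<^sup>2\<close>, for strictly positive bounds \<open>a n\<close> on the norms: the choice
  \<open>t = a (Suc m) / (\<Sum>n\<le>m. a n)\<close> makes \<open>nsq_add_le\<close> a perfect square.
\<close>

lemma nsq_sum_le:
  assumes f: "\<And>n. f n \<in> L2_space P" and a: "\<And>n. 0 < a n" "\<And>n. nsq (f n) \<le> (a n)\<^sup>2"
  shows "nsq (\<lambda>x. \<Sum>n\<le>m. f n x) \<le> (\<Sum>n\<le>m::nat. a n)\<^sup>2"
proof (induction m)
  case (Suc m)
  define A where "A = (\<Sum>n\<le>m. a n)"
  have A: "0 < A" unfolding A_def using a(1) by (intro sum_pos) auto
  let ?b = "a (Suc m)"
  have "nsq (\<lambda>x. (\<Sum>n\<le>m. f n x) + f (Suc m) x) \<le>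
      (1 + ?b / A) * nsq (\<lambda>x. \<Sum>n\<le>m. f n x) + (1 + 1 / (?b / A)) * nsq (f (Suc m))"
    using A a(1) by (intro nsq_add_le L2_sum f) auto
  also have "\<dots> \<le> (1 + ?b / A) * A\<^sup>2 + (1 + 1 / (?b / A)) * ?b\<^sup>2"
    using Suc.IH a(2)[of "Suc m"] A a(1)[of "Suc m"]
    by (intro add_mono mult_left_mono) (auto simp: A_def)
  also have "\<dots> = (A + ?b)\<^sup>2"
    using A a(1)[of "Suc m"] by (simp add: power2_eq_square field_simps)
  finally show ?case by (simp add: A_def)
qed (use a in simp)

end

section \<open>The zero-one law and the norm of averages over the past\<close>

locale iid_sequence = iid_product N P for N :: "'b measure" and P :: "(int \<Rightarrow> 'b) measure"
begin

abbreviation future_dev :: "nat \<Rightarrow> ((int \<Rightarrow> 'b) \<Rightarrow> real) \<Rightarrow> (int \<Rightarrow> 'b) \<Rightarrow> real" where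
  "future_dev n f \<equiv> \<lambda>\<omega>. avg {..<int n} f \<omega> - (\<integral>\<eta>. f \<eta> \<partial>P)"

text \<open>
  Averaging over the indices below \<open>n\<close> is conditioning on the coordinates from \<open>n\<close> on. The functions
  for which this forgets everything but the mean as \<open>n\<close> grows turn out to be all of \<open>L\<^sup>2\<close>: this is
  the zero-one law for the tail of an independent sequence.
\<close>

definition tail_trivial :: "((int \<Rightarrow> 'b) \<Rightarrow> real) \<Rightarrow> bool" where
  "tail_trivial f \<longleftrightarrow> f \<in> L2_space P \<and> (\<lambda>n. nsq (future_dev n f)) \<longlonglongrightarrow> 0"

lemma future_dev_L2: "f \<in> L2_space P \<Longrightarrow> future_dev n f \<in> L2_space P"
  by (intro L2_diff avg_L2 L2_const)

lemma nsq_future_dev_add_le: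
  assumes f: "f \<in> L2_space P" and g: "g \<in> L2_space P"
  shows "nsq (future_dev n (\<lambda>x. f x + g x)) \<le> 2 * nsq (future_dev n f) + 2 * nsq (future_dev n g)"
proof -
  have [measurable]: "f \<in> borel_measurable P" "g \<in> borel_measurable P"
    using f g by (auto intro: L2_measurable)
  have "nsq (future_dev n (\<lambda>x. f x + g x)) = nsq (\<lambda>x. future_dev n f x + future_dev n g x)"
  proof (rule integral_cong_AE)
    show "AE x in P. (future_dev n (\<lambda>x. f x + g x) x)\<^sup>2 = (future_dev n f x + future_dev n g x)\<^sup>2"
      using AE_integrable_mix[OF L2_integrable[OF f], of "{..<int n}"]
        AE_integrable_mix[OF L2_integrable[OF g], of "{..<int n}"]
      by eventually_elim (use L2_integrable[OF f] L2_integrable[OF g] in \<open>simp add: avg_def algebra_simps\<close>)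
  qed measurable
  also have "\<dots> \<le> 2 * nsq (future_dev n f) + 2 * nsq (future_dev n g)"
    using nsq_add_le[OF future_dev_L2[OF f] future_dev_L2[OF g], of 1 n n] by simp
  finally show ?thesis .
qed

lemma nsq_nonneg: "0 \<le> nsq f"
  by (rule Bochner_Integration.integral_nonneg) simp

lemma tail_trivial_add:
  assumes "tail_trivial f" "tail_trivial g" shows "tail_trivial (\<lambda>x. f x + g x)"
  unfolding tail_trivial_def
proof
  show "(\<lambda>x. f x + g x) \<in> L2_space P"
    using assms by (intro L2_add) (auto simp: tail_trivial_def)
  show "(\<lambda>n. nsq (future_dev n (\<lambda>x. f x + g x))) \<longlonglongrightarrow> 0"
  proof (rule tendsto_sandwich[OF _ _ tendsto_const])
    show "(\<lambda>n. 2 * nsq (future_dev n f) + 2 * nsq (future_dev n g)) \<longlonglongrightarrow> 0"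
      using assms by (auto simp: tail_trivial_def intro!: tendsto_eq_intros)
    show "\<forall>\<^sub>F n in sequentially. nsq (future_dev n (\<lambda>x. f x + g x)) \<le>
        2 * nsq (future_dev n f) + 2 * nsq (future_dev n g)"
      using assms by (intro always_eventually allI nsq_future_dev_add_le) (auto simp: tail_trivial_def)
  qed (intro always_eventually allI nsq_nonneg)
qed

lemma tail_trivial_cmult:
  assumes "tail_trivial f" shows "tail_trivial (\<lambda>x. c * f x)"
proof -
  have "nsq (future_dev n (\<lambda>x. c * f x)) = c\<^sup>2 * nsq (future_dev n f)" for n
  proof -
    have "(future_dev n (\<lambda>x. c * f x) \<omega>)\<^sup>2 = c\<^sup>2 * (future_dev n f \<omega>)\<^sup>2" for \<omega>
      by (simp add: avg_cmult right_diff_distrib[symmetric] power_mult_distrib)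
    then show ?thesis by simp
  qed
  then show ?thesis
    using assms by (auto simp: tail_trivial_def L2_cmult intro!: tendsto_eq_intros)
qed

lemma tail_trivial_const: "tail_trivial (\<lambda>x. c)"
  by (simp add: tail_trivial_def L2_const avg_const P.prob_space)

lemma tail_trivial_sum:
  "finite I \<Longrightarrow> (\<And>i. i \<in> I \<Longrightarrow> tail_trivial (f i)) \<Longrightarrow> tail_trivial (\<lambda>x. \<Sum>i\<in>I. f i x)"
  by (induction I rule: finite_induct) (auto intro: tail_trivial_const tail_trivial_add)

text \<open>
  Taking the deviation from the mean is a contraction, uniformly in \<open>n\<close>, so the class is closed in
  \<open>L\<^sup>2\<close>.
\<close>

lemma tail_trivial_limit:
  assumes f: "f \<in> L2_space P"
    and approx: "\<And>e. e > 0 \<Longrightarrow> \<exists>g. tail_trivial g \<and> nsq (\<lambda>x. f x - g x) < e"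
  shows "tail_trivial f"
  unfolding tail_trivial_def
proof (rule conjI[OF f], rule order_tendstoI)
  fix a :: real assume "a < 0"
  then show "\<forall>\<^sub>F n in sequentially. a < nsq (future_dev n f)"
    by (intro always_eventually allI) (rule less_le_trans[OF _ nsq_nonneg])
next
  fix e :: real assume "0 < e"
  then obtain g where g: "tail_trivial g" and e: "nsq (\<lambda>x. f x - g x) < e / 4"
    using approx[of "e / 4"] by auto
  have gL: "g \<in> L2_space P" using g by (simp add: tail_trivial_def)
  have "(\<lambda>n. nsq (future_dev n g)) \<longlonglongrightarrow> 0" using g by (simp add: tail_trivial_def)
  then have "\<forall>\<^sub>F n in sequentially. nsq (future_dev n g) < e / 4"
    by (rule order_tendstoD) (use \<open>0 < e\<close> in simp)
  then show "\<forall>\<^sub>F n in sequentially. nsq (future_dev n f) < e"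
  proof eventually_elim
    case (elim n)
    have "nsq (future_dev n (\<lambda>x. (f x - g x) + g x)) \<le>
        2 * nsq (future_dev n (\<lambda>x. f x - g x)) + 2 * nsq (future_dev n g)"
      by (intro nsq_future_dev_add_le L2_diff f gL)
    moreover have "nsq (future_dev n (\<lambda>x. f x - g x)) \<le> nsq (\<lambda>x. f x - g x)"
      by (intro nsq_avg_centered_le L2_diff f gL)
    ultimately show ?case using elim e by simp
  qed
qed

lemma tail_trivial_cong:
  assumes "tail_trivial g" "\<And>\<omega>. \<omega> \<in> space P \<Longrightarrow> f \<omega> = g \<omega>"
  shows "tail_trivial f"
proof (rule tail_trivial_limit)
  show "f \<in> L2_space P"
    using assms Bochner_Integration.integrable_cong[of P P "\<lambda>x. (f x)\<^sup>2" "\<lambda>x. (g x)\<^sup>2"]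
    by (auto simp: tail_trivial_def L2_space_def cong: measurable_cong)
  have "nsq (\<lambda>x. f x - g x) = (\<integral>x. 0 \<partial>P)"
    by (rule Bochner_Integration.integral_cong) (auto simp: assms)
  then show "\<exists>g. tail_trivial g \<and> nsq (\<lambda>x. f x - g x) < e" if "e > 0" for e
    using that assms(1) by (intro exI[of _ g]) simp
qed

lemma L2_indicator: "A \<in> sets P \<Longrightarrow> indicator A \<in> L2_space P"
  by (auto simp: L2_space_def intro!: P.integrable_const_bound[of _ 1]) (simp add: indicator_def)

text \<open>
  A box depends on finitely many coordinates only, and as soon as all of them lie below \<open>n\<close> the
  average equals the mean. Boxes are stable under intersection, and the class is closed under
  complements and disjoint unions by linearity and closedness.
\<close>

lemma tail_trivial_indicator:
  assumes "A \<in> sets P" shows "tail_trivial (indicator A)"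
proof -
  have sets_P: "sigma_sets (space P) (prod_algebra UNIV (\<lambda>_. N)) = sets P"
    unfolding P_eq by (simp add: sets_PiM space_PiM)
  have "Int_stable (prod_algebra UNIV (\<lambda>_::int. N))" by (rule Int_stable_prod_algebra)
  moreover have "prod_algebra UNIV (\<lambda>_. N) \<subseteq> Pow (space P)"
    unfolding P_eq space_PiM by (rule prod_algebra_sets_into_space)
  moreover have "A \<in> sigma_sets (space P) (prod_algebra UNIV (\<lambda>_. N))"
    using assms by (simp add: sets_P)
  ultimately show ?thesis
  proof (induction rule: sigma_sets_induct_disjoint)
    case (basic A)
    then obtain J X where A: "A = {\<omega>\<in>space P. \<forall>j\<in>J. \<omega> j \<in> X j}" and J: "finite J"
      and X: "\<And>j. j \<in> J \<Longrightarrow> X j \<in> sets N"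
      by (rule prod_algebraE) (auto simp: box_eq)
    have [measurable]: "A \<in> sets P" unfolding A using J X by (rule sets_box)
    have "\<forall>\<^sub>F n in sequentially. nsq (future_dev n (indicator A)) = 0"
    \<comment> \<open>inserting \<open>0\<close> keeps the maximum defined for the unconstrained box, \<open>J = {}\<close>\<close>
    proof (rule eventually_sequentiallyI)
      fix n assume n: "nat (Max (insert 0 J)) + 1 \<le> n"
      have J_past: "j < int n" if "j \<in> J" for j
      proof -
        have "j \<le> Max (insert 0 J)" using J that by (intro Max_ge) auto
        with n show ?thesis by linarith
      qed
      have "avg {..<int n} (indicator A) \<omega> = (\<integral>\<eta>. indicator A \<eta> \<partial>P)" if "\<omega> \<in> space P" for \<omega>
        unfolding avg_def
      proof (rule Bochner_Integration.integral_cong[OF refl])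
        fix \<eta> assume "\<eta> \<in> space P"
        moreover have "mix {..<int n} \<eta> \<omega> j = \<eta> j" if "j \<in> J" for j
          using J_past[OF that] by (simp add: mix_def)
        ultimately show "indicator A (mix {..<int n} \<eta> \<omega>) = (indicator A \<eta> :: real)"
          using that by (auto simp: A indicator_def mix_in_space)
      qed
      then have "nsq (future_dev n (indicator A)) = (\<integral>\<omega>. 0 \<partial>P)"
        by (intro Bochner_Integration.integral_cong) auto
      then show "nsq (future_dev n (indicator A)) = 0" by simp
    qed
    then have "(\<lambda>n. nsq (future_dev n (indicator A))) \<longlonglongrightarrow> 0"
      by (rule tendsto_eventually)
    then show ?case
      by (simp add: tail_trivial_def L2_indicator)
  next
    case empty
    show ?case by (rule tail_trivial_cong[OF tail_trivial_const[of 0]]) simp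
  next
    case (compl A)
    have "tail_trivial (\<lambda>x. 1 + (-1) * indicator A x)"
      by (intro tail_trivial_add tail_trivial_const tail_trivial_cmult compl)
    then show ?case by (rule tail_trivial_cong) (auto simp: indicator_def)
  next
    case (union A)
    have [measurable]: "A i \<in> sets P" for i using union(2) sets_P by auto
    have "tail_trivial (indicator (\<Union>i<m. A i))" for m
    proof -
      have "tail_trivial (\<lambda>x. \<Sum>i<m. indicator (A i) x)"
        by (intro tail_trivial_sum union) simp
      moreover have "(\<Sum>i<m. indicator (A i) x) = (indicator (\<Union>i<m. A i) x :: real)" for x
        using union(1) by (intro indicator_UN_disjoint[symmetric]) (auto simp: disjoint_family_on_def)
      ultimately show ?thesis by (simp only:)
    qed note partial = this
    show ?case
    proof (rule tail_trivial_limit)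
      show "indicator (\<Union>i. A i) \<in> L2_space P"
        by (rule L2_indicator) measurable
    next
      fix e :: real assume "e > 0"
      have "(\<lambda>m. P.prob (\<Union>i<m. A i)) \<longlonglongrightarrow> P.prob (\<Union>m. \<Union>i<m. A i)"
        by (rule P.finite_Lim_measure_incseq) (auto simp: incseq_def intro: order.strict_trans2)
      moreover have "(\<Union>m. \<Union>i<m. A i) = (\<Union>i. A i)" by auto
      ultimately have "\<forall>\<^sub>F m in sequentially. P.prob (\<Union>i. A i) - e < P.prob (\<Union>i<m. A i)"
        using \<open>e > 0\<close> by (intro order_tendstoD(1)) auto
      then obtain m where m: "P.prob (\<Union>i. A i) - e < P.prob (\<Union>i<m. A i)"
        by (auto simp: eventually_sequentially)
      have "nsq (\<lambda>x. indicator (\<Union>i. A i) x - indicator (\<Union>i<m. A i) x) =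
          (\<integral>x. indicator ((\<Union>i. A i) - (\<Union>i<m. A i)) x \<partial>P)"
        by (rule Bochner_Integration.integral_cong) (auto simp: indicator_def)
      also have "\<dots> = P.prob (\<Union>i. A i) - P.prob (\<Union>i<m. A i)"
        by (subst P.finite_measure_Diff[symmetric]) (auto simp: Int_absorb2 sets.sets_into_space)
      finally have "nsq (\<lambda>x. indicator (\<Union>i. A i) x - indicator (\<Union>i<m. A i) x) < e"
        using m by simp
      then show "\<exists>g. tail_trivial g \<and> nsq (\<lambda>x. indicator (\<Union>i. A i) x - g x) < e"
        using partial by blast
    qed
  qed
qed

theorem tail_trivial_L2:
  assumes f: "f \<in> L2_space P" shows "tail_trivial f"
proof (rule tail_trivial_limit[OF f])
  fix e :: real assume "e > 0"
  have [measurable]: "f \<in> borel_measurable P" using f by (rule L2_measurable)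
  obtain s where s: "\<And>i. simple_function P (s i)"
    and lim: "\<And>x. x \<in> space P \<Longrightarrow> (\<lambda>i. s i x) \<longlonglongrightarrow> f x"
    and bound: "\<And>i x. x \<in> space P \<Longrightarrow> \<bar>s i x\<bar> \<le> 2 * \<bar>f x\<bar>"
  proof -
    obtain s where "\<forall>i. simple_function P (s i)" "\<forall>x\<in>space P. (\<lambda>i. s i x) \<longlonglongrightarrow> f x"
      "\<forall>i. \<forall>x\<in>space P. dist (s i x) 0 \<le> 2 * dist (f x) 0"
      using borel_measurable_implies_sequence_metric[of f P 0] by auto
    then show thesis by (intro that[of s]) auto
  qed
  have [measurable]: "s i \<in> borel_measurable P" for i
    using s by (rule borel_measurable_simple_function)
  have "(\<lambda>i. nsq (\<lambda>x. f x - s i x)) \<longlonglongrightarrow> (\<integral>x. 0 \<partial>P)"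
  proof (rule integral_dominated_convergence[where w = "\<lambda>x. 9 * (f x)\<^sup>2"])
    show "AE x in P. (\<lambda>i. (f x - s i x)\<^sup>2) \<longlonglongrightarrow> 0"
      using lim by (intro AE_I2) (auto intro!: tendsto_eq_intros)
    show "AE x in P. norm ((f x - s i x)\<^sup>2) \<le> 9 * (f x)\<^sup>2" for i
    proof (rule AE_I2)
      fix x assume "x \<in> space P"
      then have "\<bar>f x - s i x\<bar> \<le> \<bar>3 * f x\<bar>" using bound[of x i] by simp
      then have "(f x - s i x)\<^sup>2 \<le> (3 * f x)\<^sup>2" by (simp only: abs_le_square_iff)
      then show "norm ((f x - s i x)\<^sup>2) \<le> 9 * (f x)\<^sup>2" by (simp add: power_mult_distrib)
    qed
  qed (use L2_integrable_sq[OF f] in auto)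
  then have "\<forall>\<^sub>F i in sequentially. nsq (\<lambda>x. f x - s i x) < e"
    using \<open>e > 0\<close> by (intro order_tendstoD(2)) auto
  then obtain i where "nsq (\<lambda>x. f x - s i x) < e"
    by (auto simp: eventually_sequentially)
  moreover have "tail_trivial (s i)"
  proof (rule tail_trivial_cong)
    have "finite (s i ` space P)" using s by (rule simple_functionD)
    then show "tail_trivial (\<lambda>x. \<Sum>y\<in>s i ` space P. y * indicator (s i -` {y} \<inter> space P) x)"
      by (intro tail_trivial_sum tail_trivial_cmult tail_trivial_indicator) measurable
    fix x assume x: "x \<in> space P"
    have "(\<Sum>y\<in>s i ` space P. y * indicator (s i -` {y} \<inter> space P) x) =
        (\<Sum>y\<in>s i ` space P. if y = s i x then y else 0)"
      using x by (intro sum.cong) (auto simp: indicator_def)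
    then show "s i x = (\<Sum>y\<in>s i ` space P. y * indicator (s i -` {y} \<inter> space P) x)"
      using x \<open>finite (s i ` space P)\<close> by (simp add: sum.delta)
  qed
  ultimately show "\<exists>g. tail_trivial g \<and> nsq (\<lambda>x. f x - g x) < e" by blast
qed

text \<open>
  Averaging over one more coordinate at a time, the squared norm decreases by at most the
  one-coordinate variance, and it decreases to \<open>0\<close> by the zero-one law. So it is at most the sum of
  the variances of the coordinates that are still present.
\<close>

theorem nsq_avg_past_le:
  assumes f: "f \<in> L2_space P" and mean: "(\<integral>\<omega>. f \<omega> \<partial>P) = 0"
    and C: "\<And>m. (\<Sum>i\<in>{n..<m}. nsq f - nsq (avg {int i} f)) \<le> C"
  shows "nsq (avg {..<int n} f) \<le> C"
proof -
  have tele: "nsq (avg {..<int n} f) \<le> C + nsq (avg {..<int m} f)" if "n \<le> m" for m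
  proof -
    have "nsq (avg {..<int n} f) - nsq (avg {..<int m} f) \<le>
        (\<Sum>i\<in>{n..<m}. nsq f - nsq (avg {int i} f))"
      using that
    proof (induction m rule: dec_induct)
      case (step m)
      have "{..<int m} \<union> {int m} = {..<int (Suc m)}" by auto
      with nsq_avg_increment[OF f, of "{..<int m}" "{int m}"] step show ?case by simp
    qed simp
    with C[of m] show ?thesis by linarith
  qed
  have "(\<lambda>m. C + nsq (avg {..<int m} f)) \<longlonglongrightarrow> C"
    using tail_trivial_L2[OF f] by (auto simp: tail_trivial_def mean intro!: tendsto_eq_intros)
  then show ?thesis
    using tele by (intro LIMSEQ_le_const[of _ C]) auto
qed

section \<open>The shift\<close>

lemma shift_measurable [measurable]: "shift \<in> measurable P P"
  by (rule measurable_into_P) (simp add: shift_def)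

lemma distr_shift: "distr P P shift = P"
proof -
  have "distr (PiM UNIV (\<lambda>_. N)) (PiM UNIV (\<lambda>_. N)) (\<lambda>\<omega>. \<lambda>n\<in>UNIV. \<omega> (n - 1)) = PiM UNIV (\<lambda>_::int. N)"
    by (rule distr_PiM_reindex[where M = "\<lambda>_. N" and f = "\<lambda>n. n - 1"])
      (auto intro: N.prob_space_axioms inj_onI)
  then show ?thesis by (simp add: P_eq shift_def[abs_def] restrict_def)
qed

lemma shift_in_space: "\<omega> \<in> space P \<Longrightarrow> shift \<omega> \<in> space P"
  using measurable_space[OF shift_measurable] .

lemma shift_pow_measurable [measurable]: "(shift ^^ n) \<in> measurable P P"
  by (induction n) (auto intro: measurable_comp[of _ P P])

lemma distr_shift_pow: "distr P P (shift ^^ n) = P"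
proof (induction n)
  case (Suc n)
  then show ?case
    using distr_distr[OF shift_measurable shift_pow_measurable[of n]] by (simp add: distr_shift comp_def)
qed (simp add: distr_id)

lemma AE_shift_pow:
  assumes "AE \<omega> in P. Q \<omega>" shows "AE \<omega> in P. Q ((shift ^^ n) \<omega>)"
  using assms by (intro AE_distrD[OF shift_pow_measurable[of n]]) (simp only: distr_shift_pow)

text \<open>
  The shift moves the coordinate \<open>n\<close> to \<open>n + 1\<close>, so resampling the indices below \<open>m\<close> before it is
  resampling the indices below \<open>m + 1\<close> after it; the shifted copy has the same law as the copy.
\<close>

lemma avg_past_shift:
  assumes h: "h \<in> borel_measurable P" and \<omega>: "\<omega> \<in> space P"
  shows "avg {..<m} (\<lambda>\<omega>. h (shift \<omega>)) \<omega> = avg {..<m + 1} h (shift \<omega>)"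
proof -
  have "shift (mix {..<m} \<eta> \<omega>) = mix {..<m + 1} (shift \<eta>) (shift \<omega>)" for \<eta>
    by (auto simp: shift_def mix_def)
  then have "avg {..<m} (\<lambda>\<omega>. h (shift \<omega>)) \<omega> = (\<integral>\<eta>. h (mix {..<m + 1} (shift \<eta>) (shift \<omega>)) \<partial>P)"
    by (simp add: avg_def)
  also have "\<dots> = (\<integral>\<eta>. h (mix {..<m + 1} \<eta> (shift \<omega>)) \<partial>distr P P shift)"
    using measurable_compose[OF measurable_mix_right[OF shift_in_space[OF \<omega>]] h]
    by (intro integral_distr[symmetric]) auto
  finally show ?thesis by (simp add: distr_shift avg_def)
qed

lemma avg_past_shift_pow:
  assumes "h \<in> borel_measurable P" "\<omega> \<in> space P"
  shows "avg {..<m} (\<lambda>\<omega>. h ((shift ^^ n) \<omega>)) \<omega> = avg {..<m + int n} h ((shift ^^ n) \<omega>)"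
  using assms
proof (induction n arbitrary: h \<omega> m)
  case (Suc n)
  have "avg {..<m} (\<lambda>\<omega>. h ((shift ^^ Suc n) \<omega>)) \<omega> = avg {..<m} (\<lambda>\<omega>. (\<lambda>\<omega>. h ((shift ^^ n) \<omega>)) (shift \<omega>)) \<omega>"
    by (simp add: funpow_swap1)
  also have "\<dots> = avg {..<m + 1} (\<lambda>\<omega>. h ((shift ^^ n) \<omega>)) (shift \<omega>)"
    using Suc.prems by (intro avg_past_shift) auto
  also have "\<dots> = avg {..<m + 1 + int n} h ((shift ^^ n) (shift \<omega>))"
    using Suc.prems by (intro Suc.IH shift_in_space)
  finally show ?case by (simp add: funpow_swap1 ac_simps)
qed simp

end

section \<open>The transfer operator on the product of cubes\<close>

lemma prob_space_cube: "prob_space (cube_measure :: (real ^ 's) measure)"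
proof
  have S: "{x :: real ^ 's. \<forall>j. 0 \<le> x $ j \<and> x $ j \<le> 1} = cbox 0 1"
    by (auto simp: mem_box_cart)
  have one: "(1 :: real ^ 's) \<bullet> b = 1" if "b \<in> Basis" for b
    using that by (auto simp: Basis_vec_def inner_axis)
  show "emeasure cube_measure (space (cube_measure :: (real ^ 's) measure)) = 1"
    unfolding cube_measure_def S
    by (simp add: emeasure_restrict_space space_restrict_space emeasure_lborel_cbox_eq one)
qed

interpretation cube: iid_sequence cube_measure product_measure
proof -
  interpret prob_space cube_measure by (rule prob_space_cube)
  show "iid_sequence cube_measure product_measure"
    by unfold_locales (rule product_measure_def)
qed

lemma space_future: "space (future_algebra m) = space product_measure"
  unfolding future_algebra_def by (rule space_measure_of) blast

lemma sets_future:
  "sets (future_algebra m :: (int \<Rightarrow> real ^ 's) measure) = sigma_sets (space product_measure)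
     (\<Union>k\<in>{m..}. {(\<lambda>\<omega>. \<omega> k) -` A \<inter> space product_measure | A. A \<in> sets cube_measure})"
  unfolding future_algebra_def by (rule sets_measure_of) blast

lemma subalgebra_future: "subalgebra product_measure (future_algebra m)"
proof -
  have "sets (future_algebra m) \<subseteq> sets product_measure"
    unfolding sets_future
    by (rule sets.sigma_sets_subset) (use measurable_sets[OF cube.measurable_coord] in blast)
  then show ?thesis by (simp add: subalgebra_def space_future)
qed

lemma measurable_coord_future:
  assumes "m \<le> i" shows "(\<lambda>\<omega>. \<omega> i) \<in> measurable (future_algebra m) cube_measure"
proof (rule measurableI)
  fix A :: "(real ^ 's) set" assume "A \<in> sets cube_measure"
  then show "(\<lambda>\<omega>. \<omega> i) -` A \<inter> space (future_algebra m) \<in> sets (future_algebra m)"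
    unfolding space_future sets_future using assms by (intro sigma_sets.Basic) blast
qed (simp add: space_future cube.space_P)

lemma future_invariant:
  assumes "A \<in> sets (future_algebra m)" "\<omega> \<in> space product_measure" "\<eta> \<in> space product_measure"
  shows "mix {..<m} \<eta> \<omega> \<in> A \<longleftrightarrow> \<omega> \<in> A"
  using assms(1) unfolding sets_future
proof induction
  case (Basic A)
  then obtain k B where "m \<le> k" "A = (\<lambda>\<omega>. \<omega> k) -` B \<inter> space product_measure" by auto
  moreover from this have "mix {..<m} \<eta> \<omega> k = \<omega> k" by (simp add: mix_def)
  ultimately show ?case using cube.mix_in_space[OF assms(2,3)] assms(2) by simp
qed (use cube.mix_in_space[OF assms(2,3)] assms(2) in auto)

lemma real_cond_exp_future:
  assumes "integrable product_measure f"
  shows "AE \<omega> in product_measure. real_cond_exp product_measure (future_algebra m) f \<omega> = cube.avg {..<m} f \<omega>"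
  by (rule cube.real_cond_exp_eq_avg[OF subalgebra_future _ future_invariant assms])
    (auto intro: measurable_coord_future)

lemma transfer_op_apply:
  "transfer_op h \<omega> = real_cond_exp product_measure (future_algebra 1) h (shift \<omega>)"
  by (simp add: transfer_op_def)

lemma transfer_op_measurable: "transfer_op h \<in> borel_measurable product_measure"
  unfolding transfer_op_def by (rule measurable_comp[OF cube.shift_measurable]) simp

lemma transfer_op_pow_measurable:
  "f \<in> borel_measurable product_measure \<Longrightarrow> (transfer_op ^^ n) f \<in> borel_measurable product_measure"
  by (cases n) (auto simp: transfer_op_measurable)

text \<open>
  Every application of the transfer operator averages over one more coordinate of \<open>f\<close> and shifts.
  For \<open>n = 0\<close> the claim is that averaging over the negative coordinates does not change \<open>f\<close>, which is
  the measurability assumption.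
\<close>

lemma transfer_op_pow:
  assumes f: "integrable product_measure f" and future: "f \<in> borel_measurable (future_algebra 0)"
  shows "AE \<omega> in product_measure. (transfer_op ^^ n) f \<omega> = cube.avg {..<int n} f ((shift ^^ n) \<omega>)"
proof (induction n)
  case 0
  interpret finite_measure_subalgebra product_measure "future_algebra 0"
    by unfold_locales (rule subalgebra_future)
  show ?case
    using real_cond_exp_F_meas[OF f future] real_cond_exp_future[OF f, of 0]
    by eventually_elim simp
next
  case (Suc n)
  let ?E = "real_cond_exp product_measure (future_algebra 1)"
  let ?g = "\<lambda>\<omega>. cube.avg {..<int n} f ((shift ^^ n) \<omega>)"
  have [measurable]: "f \<in> borel_measurable product_measure" using f by simp
  interpret finite_measure_subalgebra product_measure "future_algebra 1"
    by unfold_locales (rule subalgebra_future)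
  have "integrable (distr product_measure product_measure (shift ^^ n)) (cube.avg {..<int n} f)"
    by (simp add: cube.distr_shift_pow cube.avg_integrable[OF f])
  then have g: "integrable product_measure ?g"
    by (rule integrable_distr[OF cube.shift_pow_measurable])
  have "AE \<omega> in product_measure. ?E ((transfer_op ^^ n) f) \<omega> = ?E ?g \<omega>"
    using Suc.IH by (rule real_cond_exp_cong) (use g in \<open>auto intro: transfer_op_pow_measurable\<close>)
  moreover have "AE \<omega> in product_measure. ?E ?g \<omega> = cube.avg {..<1} ?g \<omega>"
    by (rule real_cond_exp_future[OF g])
  moreover have "AE \<omega> in product_measure. cube.avg {..<1} ?g \<omega> =
      cube.avg {..<1 + int n} (cube.avg {..<int n} f) ((shift ^^ n) \<omega>)"
    by (rule AE_I2) (rule cube.avg_past_shift_pow, measurable)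
  moreover have "AE \<omega> in product_measure. cube.avg {..<1 + int n} (cube.avg {..<int n} f) ((shift ^^ n) \<omega>) =
      cube.avg ({..<1 + int n} \<union> {..<int n}) f ((shift ^^ n) \<omega>)"
    by (rule cube.AE_shift_pow[OF cube.avg_avg[OF f]])
  ultimately have "AE \<omega> in product_measure.
      ?E ((transfer_op ^^ n) f) \<omega> = cube.avg {..<int (Suc n)} f ((shift ^^ n) \<omega>)"
  proof eventually_elim
    case (elim \<omega>)
    moreover have "{..<1 + int n} \<union> {..<int n} = {..<int (Suc n)}" by auto
    ultimately show ?case by simp
  qed
  then have "AE \<omega> in product_measure. ?E ((transfer_op ^^ n) f) ((shift ^^ 1) \<omega>) =
      cube.avg {..<int (Suc n)} f ((shift ^^ n) ((shift ^^ 1) \<omega>))"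
    by (rule cube.AE_shift_pow)
  then show ?case
    by (simp add: transfer_op_apply[of "(transfer_op ^^ n) f"] funpow_swap1[of shift])
qed

lemma nsq_transfer_op_pow:
  assumes f: "f \<in> L2_space product_measure" and future: "f \<in> borel_measurable (future_algebra 0)"
  shows "(transfer_op ^^ n) f \<in> L2_space product_measure" (is ?L2)
    and "cube.nsq ((transfer_op ^^ n) f) = cube.nsq (cube.avg {..<int n} f)" (is ?nsq)
proof -
  let ?a = "cube.avg {..<int n} f"
  have a: "?a \<in> L2_space product_measure" by (rule cube.avg_L2[OF f])
  have [measurable]: "f \<in> borel_measurable product_measure" using f by (rule cube.L2_measurable)
  have [measurable]: "(transfer_op ^^ n) f \<in> borel_measurable product_measure"
    by (rule transfer_op_pow_measurable) simp
  have eq: "AE \<omega> in product_measure. ((transfer_op ^^ n) f \<omega>)\<^sup>2 = (?a ((shift ^^ n) \<omega>))\<^sup>2"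
    using transfer_op_pow[OF cube.L2_integrable[OF f] future, of n] by eventually_elim simp
  have "integrable (distr product_measure product_measure (shift ^^ n)) (\<lambda>\<omega>. (?a \<omega>)\<^sup>2)"
    using cube.L2_integrable_sq[OF a] by (simp only: cube.distr_shift_pow)
  then have "integrable product_measure (\<lambda>\<omega>. (?a ((shift ^^ n) \<omega>))\<^sup>2)"
    by (rule integrable_distr[OF cube.shift_pow_measurable])
  then have "integrable product_measure (\<lambda>\<omega>. ((transfer_op ^^ n) f \<omega>)\<^sup>2)"
    by (subst integrable_cong_AE[OF _ _ eq]) measurable
  then show ?L2 by (simp add: L2_space_def)
  have "cube.nsq ((transfer_op ^^ n) f) = (\<integral>\<omega>. (?a ((shift ^^ n) \<omega>))\<^sup>2 \<partial>product_measure)"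
    by (rule integral_cong_AE[OF _ _ eq]) measurable
  also have "\<dots> = (\<integral>\<omega>. (?a \<omega>)\<^sup>2 \<partial>distr product_measure product_measure (shift ^^ n))"
    by (subst integral_distr) auto
  finally show ?nsq by (simp only: cube.distr_shift_pow)
qed

lemma distr_coord: "distr product_measure cube_measure (\<lambda>\<omega>. \<omega> i) = cube_measure"
  unfolding product_measure_def by (rule distr_PiM_component) (auto intro: prob_space_cube)

lemma integral_coord:
  fixes k :: "real ^ 's \<Rightarrow> real"
  assumes "k \<in> borel_measurable cube_measure"
  shows "(\<integral>\<omega>. k (\<omega> i) \<partial>product_measure) = (\<integral>x. k x \<partial>cube_measure)"
  using integral_distr[OF cube.measurable_coord[of i] assms] by (simp add: distr_coord)

lemma integrable_coord:
  fixes k :: "real ^ 's \<Rightarrow> real"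
  assumes "integrable cube_measure k"
  shows "integrable product_measure (\<lambda>\<omega>. k (\<omega> i))"
  using integrable_distr[OF cube.measurable_coord[of i], of k] assms by (simp add: distr_coord)

lemma mix_singleton: "mix {i} \<eta> \<omega> = fun_upd \<omega> i (\<eta> i)"
  by (auto simp: mix_def)

lemma avg_singleton:
  assumes "coord_section f i \<omega> \<in> borel_measurable cube_measure"
  shows "cube.avg {i} f \<omega> = (\<integral>x. coord_section f i \<omega> x \<partial>cube_measure)"
  using integral_coord[OF assms, of i] by (simp add: cube.avg_def mix_singleton coord_section_def)

section \<open>From the Poincare inequality to the Gordin class\<close>

locale dirichlet_cube =
  fixes d :: "(real ^ 's \<Rightarrow> real) set"
    and \<epsilon> :: "(real ^ 's \<Rightarrow> real) \<Rightarrow> (real ^ 's \<Rightarrow> real) \<Rightarrow> real"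
    and \<gamma> :: "(real ^ 's \<Rightarrow> real) \<Rightarrow> (real ^ 's \<Rightarrow> real) \<Rightarrow> real ^ 's \<Rightarrow> real"
    and K :: real
  assumes dirichlet: "dirichlet_form cube_measure d \<epsilon>"
    and one: "(\<lambda>_. 1) \<in> d" and energy_one: "\<epsilon> (\<lambda>_. 1) (\<lambda>_. 1) = 0"
    and carre: "carre_du_champ cube_measure d \<epsilon> \<gamma>"
    and K: "K > 0"
    and poincare: "\<And>g. g \<in> product_domain d \<gamma> \<inter> L2_centered \<Longrightarrow>
           (L2_norm product_measure g)\<^sup>2 \<le> K * product_energy \<gamma> g"
begin

lemma domain_L2: "u \<in> d \<Longrightarrow> u \<in> L2_space cube_measure"
  and domain_add: "u \<in> d \<Longrightarrow> v \<in> d \<Longrightarrow> (\<lambda>x. u x + v x) \<in> d"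
  and domain_cmult: "u \<in> d \<Longrightarrow> (\<lambda>x. c * u x) \<in> d"
  using dirichlet by (auto simp: dirichlet_form_def dense_L2_subspace_def)

lemma energy_sym: "u \<in> d \<Longrightarrow> v \<in> d \<Longrightarrow> \<epsilon> u v = \<epsilon> v u"
  and energy_add: "u \<in> d \<Longrightarrow> v \<in> d \<Longrightarrow> w \<in> d \<Longrightarrow> \<epsilon> (\<lambda>x. u x + v x) w = \<epsilon> u w + \<epsilon> v w"
  and energy_cmult: "u \<in> d \<Longrightarrow> v \<in> d \<Longrightarrow> \<epsilon> (\<lambda>x. c * u x) v = c * \<epsilon> u v"
  and energy_nonneg: "u \<in> d \<Longrightarrow> 0 \<le> \<epsilon> u u"
  using dirichlet unfolding dirichlet_form_def nonneg_symmetric_form_def by blast+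

lemma integral_gamma: "u \<in> d \<Longrightarrow> (\<integral>x. \<gamma> u u x \<partial>cube_measure) = 2 * \<epsilon> u u"
proof -
  have "\<forall>u\<in>d. \<epsilon> u u = (\<integral>x. \<gamma> u u x \<partial>cube_measure) / 2"
    using carre unfolding carre_du_champ_def by (elim conjE)
  then show "(\<integral>x. \<gamma> u u x \<partial>cube_measure) = 2 * \<epsilon> u u" if "u \<in> d"
    using that by force
qed

lemma domain_const: "(\<lambda>_. c) \<in> d"
  using domain_cmult[OF one, of c] by simp

lemma energy_const: "\<epsilon> (\<lambda>_. c) (\<lambda>_. c) = 0"
  using energy_cmult[OF one domain_const, of c c] energy_sym[OF one domain_const, of c]
    energy_cmult[OF one one, of c] by (simp add: energy_one)

lemma energy_add_sq:
  assumes "u \<in> d" "v \<in> d"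
  shows "\<epsilon> (\<lambda>x. u x + v x) (\<lambda>x. u x + v x) = \<epsilon> u u + 2 * \<epsilon> u v + \<epsilon> v v"
  using assms energy_add[OF assms domain_add[OF assms]]
    energy_sym[OF assms(1) domain_add[OF assms]] energy_sym[OF assms(2) domain_add[OF assms]]
    energy_add[OF assms assms(1)] energy_add[OF assms assms(2)] energy_sym[OF assms] by simp

text \<open>
  Constants are orthogonal to everything: \<open>\<epsilon>(u + t, u + t)\<close> is nonnegative and affine in \<open>t\<close> since
  \<open>\<epsilon>(1, 1) = 0\<close>, so its slope vanishes.
\<close>

lemma energy_one_right:
  assumes u: "u \<in> d" shows "\<epsilon> u (\<lambda>_. 1) = 0"
proof (rule ccontr)
  let ?b = "\<epsilon> u (\<lambda>_. 1)"
  assume b: "?b \<noteq> 0"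
  \<comment> \<open>the affine function takes the value \<open>-1\<close> here\<close>
  define t where "t = - (\<epsilon> u u + 1) / (2 * ?b)"
  have "\<epsilon> u (\<lambda>_. t) = t * ?b"
    using energy_sym[OF u domain_const, of t] energy_cmult[OF one u, of t] energy_sym[OF u one] by simp
  then have "\<epsilon> (\<lambda>x. u x + t) (\<lambda>x. u x + t) = \<epsilon> u u + 2 * (t * ?b)"
    using energy_add_sq[OF u domain_const, of t] by (simp add: energy_const)
  also have "\<dots> = -1" using b by (simp add: t_def field_simps)
  finally show False using energy_nonneg[OF domain_add[OF u domain_const], of t] by simp
qed

lemma energy_add_const:
  assumes u: "u \<in> d" shows "\<epsilon> (\<lambda>x. u x + c) (\<lambda>x. u x + c) = \<epsilon> u u"
  using energy_add_sq[OF u domain_const, of c] energy_sym[OF u domain_const, of c]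
    energy_cmult[OF one u, of c] energy_sym[OF u one] energy_one_right[OF u]
  by (simp add: energy_const)

text \<open>
  The section does not depend on the \<open>i\<close>-th coordinate of its base point, so the energy identity for
  \<open>\<gamma>\<close> applies to the integral over that coordinate. This turns the one-coordinate Poincare inequality into a bound by \<open>mean_coord_gamma\<close>.
\<close>

lemma integral_coord_gamma:
  assumes "coord_section f i \<omega> \<in> d"
  shows "(\<integral>x. coord_gamma \<gamma> i f (fun_upd \<omega> i x) \<partial>cube_measure) =
    2 * \<epsilon> (coord_section f i \<omega>) (coord_section f i \<omega>)"
proof -
  have "coord_section f i (fun_upd \<omega> i x) = coord_section f i \<omega>" for x
    by (simp add: coord_section_def)
  then show ?thesis using integral_gamma[OF assms] by (simp add: coord_gamma_def)
qed

text \<open>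
  The Poincare inequality of the product, tested on a centered function of the coordinate \<open>0\<close> alone,
  is a Poincare inequality for \<open>\<epsilon>\<close> with the same constant: all other sections of such a function
  are constant and carry no energy.
\<close>

lemma variance_le_energy:
  assumes u: "u \<in> d"
  shows "(\<integral>x. (u x)\<^sup>2 \<partial>cube_measure) - (\<integral>x. u x \<partial>cube_measure)\<^sup>2 \<le> K * \<epsilon> u u"
proof -
  define c where "c = (\<integral>x. u x \<partial>cube_measure)"
  define w where "w = (\<lambda>x. u x + (- c))"
  define g :: "(int \<Rightarrow> real ^ 's) \<Rightarrow> real" where "g = (\<lambda>\<omega>. w (\<omega> 0))"
  have w: "w \<in> d" unfolding w_def by (intro domain_add u domain_const)
  have [measurable]: "u \<in> borel_measurable cube_measure" "w \<in> borel_measurable cube_measure"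
    and u2: "integrable cube_measure (\<lambda>x. (u x)\<^sup>2)" and w2: "integrable cube_measure (\<lambda>x. (w x)\<^sup>2)"
    using domain_L2[OF u] domain_L2[OF w] by (auto simp: L2_space_def)
  have u1: "integrable cube_measure u"
    using u2 by (rule cube.N.square_integrable_imp_integrable[rotated]) measurable
  have g_section: "coord_section g i \<omega> = (if i = 0 then w else (\<lambda>_. g \<omega>))" for i \<omega>
    by (auto simp: coord_section_def g_def)
  have section_d: "coord_section g i \<omega> \<in> d" for i \<omega>
    by (simp add: g_section w domain_const)
  have mean: "mean_coord_gamma \<gamma> i g = (if i = 0 then ennreal (2 * \<epsilon> w w) else 0)" for i
    unfolding mean_coord_gamma_def integral_coord_gamma[OF section_d]
    by (simp add: g_section energy_const cube.P.emeasure_space_1)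
  have "mean_Gamma \<gamma> g = (\<Sum>\<^sub>\<infinity>i\<in>{0}. mean_coord_gamma \<gamma> i g)"
    unfolding mean_Gamma_def by (rule infsum_cong_neutral) (auto simp: mean)
  then have Gamma: "mean_Gamma \<gamma> g = ennreal (2 * \<epsilon> w w)" by (simp add: mean)
  have gL2: "g \<in> L2_space product_measure"
    using integrable_coord[OF w2, of 0] by (auto simp: L2_space_def g_def)
  have "g \<in> product_domain d \<gamma>"
    by (simp add: product_domain_def gL2 section_d Gamma)
  moreover have "(\<integral>\<omega>. g \<omega> \<partial>product_measure) = 0"
    using integral_coord[of w 0] u1 by (simp add: g_def w_def c_def cube.N.prob_space)
  ultimately have "(L2_norm product_measure g)\<^sup>2 \<le> K * product_energy \<gamma> g"
    using gL2 by (intro poincare) (auto simp: L2_centered_def)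
  moreover have "product_energy \<gamma> g = \<epsilon> u u"
    using energy_nonneg[OF w] energy_add_const[OF u, of "- c"]
    by (simp add: product_energy_def Gamma w_def)
  moreover have "(L2_norm product_measure g)\<^sup>2 = (\<integral>x. (w x)\<^sup>2 \<partial>cube_measure)"
    using integral_coord[of "\<lambda>x. (w x)\<^sup>2" 0] by (simp add: L2_norm_def g_def)
  ultimately show ?thesis
    using cube.N.variance_eq[OF u1 u2] by (simp add: w_def c_def)
qed

text \<open>
  This is \<open>variance_le_energy\<close> for the sections, integrated over the other coordinates. The
  constant stands on the left, inside an integral of a measurable function, because the integrand of
  \<open>mean_coord_gamma\<close> need not be measurable and only monotonicity is available for it.
\<close>

lemma variance_coord_le:
  assumes f: "f \<in> L2_space product_measure"
    and sections: "AE \<omega> in product_measure. coord_section f i \<omega> \<in> d"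
  shows "ennreal (2 / K * (cube.nsq f - cube.nsq (cube.avg {i} f))) \<le> mean_coord_gamma \<gamma> i f"
proof -
  \<comment> \<open>the conditional variance of \<open>f\<close> in its \<open>i\<close>-th coordinate\<close>
  define r where "r \<omega> = cube.avg {i} (\<lambda>x. (f x)\<^sup>2) \<omega> - (cube.avg {i} f \<omega>)\<^sup>2" for \<omega>
  note 2 = cube.L2_integrable_sq[OF f]
  have r: "integrable product_measure r"
    unfolding r_def
    by (intro Bochner_Integration.integrable_diff cube.avg_integrable[OF 2] cube.L2_integrable_sq cube.avg_L2 f)
  have r_nonneg: "AE \<omega> in product_measure. 0 \<le> 2 / K * r \<omega>"
    using cube.avg_sq_le[OF f, of "{i}"] by eventually_elim (use K in \<open>simp add: r_def\<close>)
  have "(\<integral>\<omega>. 2 / K * r \<omega> \<partial>product_measure) = 2 / K * (cube.nsq f - cube.nsq (cube.avg {i} f))"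
    unfolding r_def
    by (simp add: cube.avg_integrable[OF 2] cube.L2_integrable_sq[OF cube.avg_L2[OF f]] cube.integral_avg[OF 2])
  moreover have "ennreal (\<integral>\<omega>. 2 / K * r \<omega> \<partial>product_measure) = (\<integral>\<^sup>+\<omega>. ennreal (2 / K * r \<omega>) \<partial>product_measure)"
    by (rule nn_integral_eq_integral[symmetric, OF _ r_nonneg]) (simp add: r)
  moreover have "(\<integral>\<^sup>+\<omega>. ennreal (2 / K * r \<omega>) \<partial>product_measure) \<le> mean_coord_gamma \<gamma> i f"
    unfolding mean_coord_gamma_def
  proof (rule nn_integral_mono_AE)
    show "AE \<omega> in product_measure. ennreal (2 / K * r \<omega>) \<le>
        ennreal (\<integral>x. coord_gamma \<gamma> i f (fun_upd \<omega> i x) \<partial>cube_measure)"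
      using sections
    proof eventually_elim
      case (elim \<omega>)
      let ?s = "coord_section f i \<omega>"
      have [measurable]: "?s \<in> borel_measurable cube_measure"
        using domain_L2[OF elim] by (simp add: L2_space_def)
      have sq: "coord_section (\<lambda>x. (f x)\<^sup>2) i \<omega> = (\<lambda>x. (?s x)\<^sup>2)"
        by (simp add: coord_section_def)
      have "r \<omega> \<le> K * \<epsilon> ?s ?s"
        using variance_le_energy[OF elim] by (simp add: r_def avg_singleton sq)
      then have "2 / K * r \<omega> \<le> 2 * \<epsilon> ?s ?s" using K by (simp add: field_simps)
      then show ?case by (simp add: integral_coord_gamma[OF elim] ennreal_leI)
    qed
  qed
  ultimately show ?thesis by (simp only:)
qed

lemma tail_energy_finite:
  assumes "f \<in> product_domain d \<gamma>"
  shows "(\<Sum>\<^sub>\<infinity>i\<in>I. mean_coord_gamma \<gamma> i f) < \<infinity>"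
proof -
  have "(\<Sum>\<^sub>\<infinity>i\<in>I. mean_coord_gamma \<gamma> i f) \<le> mean_Gamma \<gamma> f"
    unfolding mean_Gamma_def by (rule infsum_mono_neutral) (auto intro: nonneg_summable_on_complete)
  with assms show ?thesis by (auto simp: product_domain_def intro: le_less_trans)
qed

text \<open>
  The Poincare inequality for the conditional expectation, with the energy of the conditional
  expectation already replaced by the tail of the energy of \<open>f\<close>.
\<close>

lemma nsq_avg_past_le_tail_energy:
  assumes f: "f \<in> product_domain d \<gamma>" and mean: "(\<integral>\<omega>. f \<omega> \<partial>product_measure) = 0"
  shows "cube.nsq (cube.avg {..<int n} f) \<le>
    K / 2 * enn2real (\<Sum>\<^sub>\<infinity>i\<in>{int n..}. mean_coord_gamma \<gamma> i f)"
proof (rule cube.nsq_avg_past_le[OF _ mean])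
  show fL2: "f \<in> L2_space product_measure" using f by (simp add: product_domain_def)
  fix m
  let ?V = "\<lambda>i. cube.nsq f - cube.nsq (cube.avg {i} f)"
  let ?t = "\<Sum>\<^sub>\<infinity>i\<in>{int n..}. mean_coord_gamma \<gamma> i f"
  have V: "0 \<le> 2 / K * ?V i" for i using K cube.nsq_avg_le[OF fL2, of "{i}"] by simp
  have "ennreal (2 / K * (\<Sum>i\<in>{n..<m}. ?V (int i))) = (\<Sum>i\<in>{n..<m}. ennreal (2 / K * ?V (int i)))"
    using V by (subst sum_ennreal) (auto simp: sum_distrib_left)
  also have "\<dots> \<le> (\<Sum>i\<in>{n..<m}. mean_coord_gamma \<gamma> (int i) f)"
    using f by (intro sum_mono variance_coord_le fL2) (simp add: product_domain_def)
  also have "\<dots> = (\<Sum>\<^sub>\<infinity>i\<in>int ` {n..<m}. mean_coord_gamma \<gamma> i f)"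
    by (simp add: sum.reindex)
  also have "\<dots> \<le> ?t"
    by (rule infsum_mono_neutral) (auto intro: nonneg_summable_on_complete)
  finally have "enn2real (ennreal (2 / K * (\<Sum>i\<in>{n..<m}. ?V (int i)))) \<le> enn2real ?t"
    using tail_energy_finite[OF f, of "{int n..}"] by (intro enn2real_mono) (simp_all add: top.not_eq_extremum)
  moreover have "0 \<le> 2 / K * (\<Sum>i\<in>{n..<m}. ?V (int i))"
    unfolding sum_distrib_left by (rule sum_nonneg) (rule V)
  ultimately have "2 / K * (\<Sum>i\<in>{n..<m}. ?V (int i)) \<le> enn2real ?t" by simp
  then show "(\<Sum>i\<in>{n..<m}. ?V (int i)) \<le> K / 2 * enn2real ?t"
    using K by (simp add: field_simps)
qed

theorem summable_tail_energy_imp_gordin: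
  assumes f: "f \<in> product_domain0 d \<gamma>"
    and summable: "summable (\<lambda>k::nat. sqrt (enn2real (\<Sum>\<^sub>\<infinity>i\<in>{int k..}. mean_coord_gamma \<gamma> i f)))"
  shows "f \<in> gordin_class"
proof -
  have fD: "f \<in> product_domain d \<gamma>" and mean: "(\<integral>\<omega>. f \<omega> \<partial>product_measure) = 0"
    and future: "f \<in> borel_measurable (future_algebra 0)"
    using f by (auto simp: product_domain0_def)
  have fL2: "f \<in> L2_space product_measure" using fD by (simp add: product_domain_def)
  let ?t = "\<lambda>k::nat. enn2real (\<Sum>\<^sub>\<infinity>i\<in>{int k..}. mean_coord_gamma \<gamma> i f)"
  \<comment> \<open>the geometric term makes the bounds strictly positive, as \<open>nsq_sum_le\<close> requires\<close>
  define a where "a k = sqrt (K / 2) * sqrt (?t k) + (1 / 2) ^ k" for k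
  have a_pos: "0 < a k" for k
    unfolding a_def using K by (intro add_nonneg_pos) auto
  have a_summable: "summable a"
    unfolding a_def by (intro summable_add summable_mult summable summable_geometric) simp
  let ?T = "\<lambda>n. (transfer_op ^^ n) f"
  have T_L2: "?T n \<in> L2_space product_measure" for n
    by (rule nsq_transfer_op_pow[OF fL2 future])
  have T_le: "cube.nsq (?T n) \<le> (a n)\<^sup>2" for n
  proof -
    have "cube.nsq (?T n) \<le> K / 2 * ?t n"
      using nsq_avg_past_le_tail_energy[OF fD mean] by (simp add: nsq_transfer_op_pow[OF fL2 future])
    also have "\<dots> = (sqrt (K / 2) * sqrt (?t n))\<^sup>2"
      using K by (simp add: power_mult_distrib)
    also have "\<dots> \<le> (a n)\<^sup>2"
      unfolding a_def using K by (intro power_mono) auto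
    finally show ?thesis .
  qed
  have sum_eq: "gordin_sum m f = (\<lambda>\<omega>. \<Sum>n\<le>m. ?T n \<omega>)" for m
    by (simp add: gordin_sum_def mean)
  have "L2_norm product_measure (gordin_sum m f) \<le> suminf a" for m
  proof -
    have "L2_norm product_measure (gordin_sum m f) \<le> sqrt ((\<Sum>n\<le>m. a n)\<^sup>2)"
      unfolding L2_norm_def sum_eq
      by (intro real_sqrt_le_mono cube.nsq_sum_le T_L2 a_pos T_le)
    also have "\<dots> = (\<Sum>n\<le>m. a n)" using a_pos by (simp add: sum_nonneg less_imp_le)
    also have "\<dots> \<le> suminf a" using a_pos by (intro sum_le_suminf a_summable) (auto intro: less_imp_le)
    finally show ?thesis .
  qed
  moreover have "gordin_sum m f \<in> L2_space product_measure" for m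
    unfolding sum_eq by (intro cube.L2_sum T_L2) simp
  ultimately show ?thesis
    using fL2 future by (auto simp: gordin_class_def)
qed

end

theorem proposition11:
  fixes d :: "(real ^ 's \<Rightarrow> real) set"
    and \<epsilon> :: "(real ^ 's \<Rightarrow> real) \<Rightarrow> (real ^ 's \<Rightarrow> real) \<Rightarrow> real"
    and \<gamma> :: "(real ^ 's \<Rightarrow> real) \<Rightarrow> (real ^ 's \<Rightarrow> real) \<Rightarrow> real ^ 's \<Rightarrow> real"
    and f :: "(int \<Rightarrow> real ^ 's) \<Rightarrow> real"
  assumes "dirichlet_form cube_measure d \<epsilon>"
    and "(\<lambda>_. 1) \<in> d" and "\<epsilon> (\<lambda>_. 1) (\<lambda>_. 1) = 0"
    and "carre_du_champ cube_measure d \<epsilon> \<gamma>"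
    and "\<exists>K>0. \<forall>g \<in> product_domain d \<gamma> \<inter> L2_centered.
           (L2_norm product_measure g)\<^sup>2 \<le> K * product_energy \<gamma> g"
    and "f \<in> product_domain0 d \<gamma>"
    and "summable (\<lambda>k::nat. sqrt (enn2real (\<Sum>\<^sub>\<infinity>i\<in>{int k..}. mean_coord_gamma \<gamma> i f)))"
  shows "f \<in> gordin_class"
proof -
  obtain K where "K > 0" and "\<And>g. g \<in> product_domain d \<gamma> \<inter> L2_centered \<Longrightarrow>
      (L2_norm product_measure g)\<^sup>2 \<le> K * product_energy \<gamma> g"
    using assms(5) by blast
  then interpret dirichlet_cube d \<epsilon> \<gamma> K
    using assms(1-4) by unfold_locales
  show ?thesis using assms(6,7) by (rule summable_tail_energy_imp_gordin)
qed

end
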